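(* Let $(\mathcal W\times\mathcal T,\mathbf K(W|T))$ be a transition probability space and let $\mathbf X:\mathcal W\times\mathcal T\dashrightarrow\mathcal X$, $\mathbf Y:\mathcal W\times\mathcal T\dashrightarrow\mathcal Y$, $\mathbf Z:\mathcal W\times\mathcal T\dashrightarrow\mathcal Z$, $\mathbf U:\mathcal W\times\mathcal T\dashrightarrow\mathcal U$ be transitional random variables (with values in arbitrary measurable spaces). Write $\perp\!\!\!\perp$ for transitional conditional independence $\perp\!\!\!\perp_{\mathbf K(W|T)}$. Then the following rules hold. a) (Extended Left Redundancy) $\mathbf X\precsim_{\mathbf K}\mathbf Z\implies \mathbf X\perp\!\!\!\perp\mathbf Y\mid\mathbf Z$. b) ($\mathbf T$-Restricted Right Redundancy) If $(\mathcal X,\mathcal Z,\mathcal T)$ is a disintegration triple, then $\mathbf X\perp\!\!\!\perp\boldsymbol\delta_\ast\mid\mathbf Z\otimes\mathbf T$. c) (Left Decomposition) $\mathbf X\otimes\mathbf U\perp\!\!\!\perp\mathbf Y\mid\mathbf Z\implies\mathbf U\perp\!\!\!\perp\mathbf Y\mid\mathbf Z$. d) (Right Decomposition) $\mathbf X\perp\!\!\!\perp\mathbf Y\otimes\mathbf U\mid\mathbf Z\implies\mathbf X\perp\!\!\!\perp\mathbf U\mid\mathbf Z$. e) ($\mathbf T$-Inverted Right Decomposition) $\mathbf X\perp\!\!\!\perp\mathbf Y\mid\mathbf Z\implies\mathbf X\perp\!\!\!\perp\mathbf T\otimes\mathbf Y\mid\mathbf Z$. f) (Left Weak Union) If $(\mathcal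 X,\mathcal U,\mathcal Z)$ is a disintegration triple, then $\mathbf X\otimes\mathbf U\perp\!\!\!\perp\mathbf Y\mid\mathbf Z\implies\mathbf X\perp\!\!\!\perp\mathbf Y\mid\mathbf U\otimes\mathbf Z$. g) (Right Weak Union) $\mathbf X\perp\!\!\!\perp\mathbf Y\otimes\mathbf U\mid\mathbf Z\implies\mathbf X\perp\!\!\!\perp\mathbf Y\mid\mathbf U\otimes\mathbf Z$. h) (Left Contraction) $(\mathbf X\perp\!\!\!\perp\mathbf Y\mid\mathbf U\otimes\mathbf Z)\land(\mathbf U\perp\!\!\!\perp\mathbf Y\mid\mathbf Z)\implies\mathbf X\otimes\mathbf U\perp\!\!\!\perp\mathbf Y\mid\mathbf Z$. i) (Right Contraction) $(\mathbf X\perp\!\!\!\perp\mathbf Y\mid\mathbf U\otimes\mathbf Z)\land(\mathbf X\perp\!\!\!\perp\mathbf U\mid\mathbf Z)\implies\mathbf X\perp\!\!\!\perp\mathbf Y\otimes\mathbf U\mid\mathbf Z$. j) (Right Cross Contraction) $(\mathbf X\perp\!\!\!\perp\mathbf Y\mid\mathbf U\otimes\mathbf Z)\land(\mathbf U\perp\!\!\!\perp\mathbf X\mid\mathbf Z)\implies\mathbf X\perp\!\!\!\perp\mathbf Y\otimes\mathbf U\mid\mathbf Z$. k) (Flipped Left Cross Contraction) $(\mathbf X\perp\!\!\!\perp\mathbf Y\mid\mathbf U\otimes\mathbf Z)\land(\mathbf Y\perp\!\!\!\perp\mathbf U\mid\mathbf Z)\implies\mathbf Y\perp\!\!\!\perp\mathbf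 X\otimes\mathbf U\mid\mathbf Z$.
   Context: A Markov kernel $\mathbf K(W|T):\mathcal T\dashrightarrow\mathcal W$ between measurable spaces is a map $(D,t)\mapsto\mathbf K(W\in D|T=t)\in[0,1]$ that is a probability measure in the measurable set $D\subseteq\mathcal W$ for each $t$ and measurable in $t$ for each $D$. Product spaces carry product $\sigma$-algebras. For kernels $\mathbf Q(X|Z):\mathcal Z\dashrightarrow\mathcal X$ and $\mathbf K(Y,Z|T):\mathcal T\dashrightarrow\mathcal Y\times\mathcal Z$ the product $\mathbf Q(X|Z)\otimes\mathbf K(Y,Z|T):\mathcal T\dashrightarrow\mathcal X\times\mathcal Y\times\mathcal Z$ is the kernel whose value on $A\times B\times C$ at $t$ is $\int\mathbf 1_B(y)\mathbf 1_C(z)\,\mathbf Q(X\in A|Z=z)\,\mathbf K((Y,Z)\in d(y,z)|T=t)$; analogously for other wirings (the arguments of the left kernel that are outputs of the right one are integrated, all outputs are kept, all remaining arguments become inputs). A transition probability space is a pair $(\mathcal W\times\mathcal T,\mathbf K(W|T))$ with $\mathbf K(W|T):\mathcal T\dashrightarrow\mathcal W$ a Markov kernel. A transitional random variable is a Markov kernel $\mathbf X:\mathcal W\times\mathcal T\dashrightarrow\mathcal X$ to a measurable space. $\mathbf X\otimes\mathbf Y:\mathcal W\times\mathcal T\dashrightarrow\mathcal X\times\mathcal Y$ is the kernel sending $(w,t)$ to the product measure of $\mathbf X(\cdot|w,t)$ and $\mathbf Y(\cdot|w,t)$. The joint kernel of $\mathbf X,\mathbf Y,\mathbf Z$ is $\mathbf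 K(X,Y,Z|T=t)(E)=\int(\mathbf X\otimes\mathbf Y\otimes\mathbf Z)(E|w,t)\,\mathbf K(W\in dw|T=t)$ (similarly for any finite number of variables; repeated occurrences of the same kernel are treated as separate factors of the product); $\mathbf K(Y,Z|T)$ etc. denote its marginals. $\mathbf T$ is the Dirac kernel $(w,t)\mapsto\boldsymbol\delta_t$ on $\mathcal T$, and $\boldsymbol\delta_\ast$ is the constant transitional random variable with values in the one-point space $\{\ast\}$. Transitional conditional independence: $\mathbf X\perp\!\!\!\perp_{\mathbf K(W|T)}\mathbf Y\mid\mathbf Z$ means that there exists a Markov kernel $\mathbf Q(X|Z):\mathcal Z\dashrightarrow\mathcal X$ with $\mathbf K(X,Y,Z|T)=\mathbf Q(X|Z)\otimes\mathbf K(Y,Z|T)$. $\mathbf X\precsim_{\mathbf K}\mathbf Z$ means: there is a measurable map $\varphi:\mathcal Z\to\mathcal X$ with $\mathbf K(X,Z|T)=\boldsymbol\delta_\varphi(X|Z)\otimes\mathbf K(Z|T)$, where $\boldsymbol\delta_\varphi(X\in A|Z=z)=\mathbf 1_A(\varphi(z))$. A triple $(\mathcal X,\mathcal Y,\mathcal Z)$ of measurable spaces is a disintegration triple if every Markov kernel $\mathbf K(X,Y|Z):\mathcal Z\dashrightarrow\mathcal X\times\mathcal Y$ admits a Markov kernel $\mathbf K(X|Y,Z):\mathcal Y\times\mathcal Z\dashrightarrow\mathcal X$ with $\mathbf K(X,Y|Z)=\mathbf K(X|Y,Z)\otimes\mathbf K(Y|Z)$, i.e. $\mathbf K(X\in A,Y\in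 B|Z=z)=\int_B\mathbf K(X\in A|Y=y,Z=z)\,\mathbf K(Y\in dy|Z=z)$ for all measurable $A,B$ and all $z$. *)

theory Defs
  imports "HOL-Probability.Probability"
begin

text \<open>
  A measurable space is given by the underlying sigma-algebra of a \<open>'a measure\<close>; the
  measure it carries is irrelevant. A Markov kernel is a measurable map into the library's
  space \<^const>\<open>prob_algebra\<close> of probability measures. Kernels only matter on the
  carrier of their source, so two kernels are equal if they agree there.
\<close>

abbreviation markov_kernel :: "'a measure \<Rightarrow> 'b measure \<Rightarrow> ('a \<Rightarrow> 'b measure) \<Rightarrow> bool" where
  "markov_kernel S M K \<equiv> K \<in> S \<rightarrow>\<^sub>M prob_algebra M"

definition transition_probability_space ::
    "'w measure \<Rightarrow> 't measure \<Rightarrow> ('t \<Rightarrow> 'w measure) \<Rightarrow> bool" where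
  "transition_probability_space W T K \<longleftrightarrow> markov_kernel T W K"

definition transitional_random_variable ::
    "'w measure \<Rightarrow> 't measure \<Rightarrow> 'x measure \<Rightarrow> ('w \<times> 't \<Rightarrow> 'x measure) \<Rightarrow> bool" where
  "transitional_random_variable W T \<X> X \<longleftrightarrow> markov_kernel (W \<Otimes>\<^sub>M T) \<X> X"

definition tensor :: "('a \<Rightarrow> 'x measure) \<Rightarrow> ('a \<Rightarrow> 'y measure) \<Rightarrow> 'a \<Rightarrow> ('x \<times> 'y) measure"
    (infixr "\<Otimes>\<^sub>K" 80) where
  "(X \<Otimes>\<^sub>K Y) p = X p \<Otimes>\<^sub>M Y p"

definition input_var :: "'t measure \<Rightarrow> 'w \<times> 't \<Rightarrow> 't measure" where
  "input_var T = (\<lambda>(w, t). return T t)"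

abbreviation point_space :: "unit measure" where
  "point_space \<equiv> count_space UNIV"

definition delta_star :: "'w \<times> 't \<Rightarrow> unit measure" where
  "delta_star = (\<lambda>p. return point_space ())"

text \<open>
  The joint kernel of several variables is \<open>joint_kernel\<close> applied to their tensor product.
\<close>

definition joint_kernel ::
    "('t \<Rightarrow> 'w measure) \<Rightarrow> ('w \<times> 't \<Rightarrow> 'v measure) \<Rightarrow> 't \<Rightarrow> 'v measure" where
  "joint_kernel K V t = K t \<bind> (\<lambda>w. V (w, t))"

definition snd_marginal ::
    "'y measure \<Rightarrow> ('t \<Rightarrow> ('x \<times> 'y) measure) \<Rightarrow> 't \<Rightarrow> 'y measure" where
  "snd_marginal \<Y> J t = distr (J t) \<Y> snd"

text \<open>
  The product \<open>L \<otimes> R\<close> of kernels, where \<open>R\<close> has values in \<open>S\<close>. The left kernel is given all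
  outputs \<open>s\<close> and inputs \<open>t\<close> of the right one; a wiring in which it uses only some of
  these is a function \<open>L\<close> that ignores the others.
\<close>

definition kernel_prod ::
    "'s measure \<Rightarrow> ('s \<times> 't \<Rightarrow> 'x measure) \<Rightarrow> ('t \<Rightarrow> 's measure) \<Rightarrow> 't \<Rightarrow> ('x \<times> 's) measure" where
  "kernel_prod S L R t = R t \<bind> (\<lambda>s. L (s, t) \<Otimes>\<^sub>M return S s)"

lemma emeasure_joint_kernel:
  assumes K: "markov_kernel T W K" and V: "markov_kernel (W \<Otimes>\<^sub>M T) M V"
    and t: "t \<in> space T" and E: "E \<in> sets M"
  shows "emeasure (joint_kernel K V t) E = (\<integral>\<^sup>+ w. emeasure (V (w, t)) E \<partial>K t)"
proof -
  have Kt: "K t \<in> space (prob_algebra W)"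
    using measurable_space[OF K t] .
  then have sK: "sets (K t) = sets W" and pK: "prob_space (K t)"
    by (auto simp: space_prob_algebra)
  have "(\<lambda>w. V (w, t)) \<in> W \<rightarrow>\<^sub>M prob_algebra M"
    using measurable_compose[OF measurable_Pair2'[OF t] V] by (simp add: comp_def)
  then have "(\<lambda>w. V (w, t)) \<in> K t \<rightarrow>\<^sub>M subprob_algebra M"
    using sK measurable_cong_sets measurable_prob_algebraD by blast
  then show ?thesis
    unfolding joint_kernel_def
    by (intro emeasure_bind[OF prob_space.not_empty[OF pK] _ E])
qed

lemma emeasure_kernel_prod_Times:
  assumes R: "markov_kernel T S R" and L: "markov_kernel (S \<Otimes>\<^sub>M T) M L"
    and t: "t \<in> space T" and A: "A \<in> sets M" and B: "B \<in> sets S"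
  shows "emeasure (kernel_prod S L R t) (A \<times> B)
         = (\<integral>\<^sup>+ s. indicator B s * emeasure (L (s, t)) A \<partial>R t)"
proof -
  have "R t \<in> space (prob_algebra S)"
    using measurable_space[OF R t] .
  then have sR: "sets (R t) = sets S" and pR: "prob_space (R t)"
    by (auto simp: space_prob_algebra)
  have Lt: "(\<lambda>s. L (s, t)) \<in> S \<rightarrow>\<^sub>M prob_algebra M"
    using measurable_compose[OF measurable_Pair2'[OF t] L] by (simp add: comp_def)
  have "(\<lambda>s. L (s, t) \<Otimes>\<^sub>M return S s) \<in> S \<rightarrow>\<^sub>M prob_algebra (M \<Otimes>\<^sub>M S)"
    by (intro measurable_pair_prob Lt measurable_return_prob_space)
  then have "(\<lambda>s. L (s, t) \<Otimes>\<^sub>M return S s) \<in> R t \<rightarrow>\<^sub>M subprob_algebra (M \<Otimes>\<^sub>M S)"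
    using sR measurable_cong_sets measurable_prob_algebraD by blast
  then have "emeasure (kernel_prod S L R t) (A \<times> B)
      = (\<integral>\<^sup>+ s. emeasure (L (s, t) \<Otimes>\<^sub>M return S s) (A \<times> B) \<partial>R t)"
    unfolding kernel_prod_def
    by (intro emeasure_bind[OF prob_space.not_empty[OF pR]]) (use A B in auto)
  also have "\<dots> = (\<integral>\<^sup>+ s. indicator B s * emeasure (L (s, t)) A \<partial>R t)"
  proof (intro nn_integral_cong)
    fix s assume "s \<in> space (R t)"
    then have s: "s \<in> space S"
      using sR sets_eq_imp_space_eq by blast
    interpret D: prob_space "return S s"
      using s by (rule prob_space_return)
    have "L (s, t) \<in> space (prob_algebra M)"
      using measurable_space[OF Lt s] .
    then have "sets (L (s, t)) = sets M"
      by (simp add: space_prob_algebra)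
    then show "emeasure (L (s, t) \<Otimes>\<^sub>M return S s) (A \<times> B)
        = indicator B s * emeasure (L (s, t)) A"
      using A B s by (subst D.emeasure_pair_measure_Times) (auto simp: mult.commute)
  qed
  finally show ?thesis .
qed

text \<open>
  In \<open>trans_ci T K \<X> X \<Y> Y \<Z> Z\<close> each variable is preceded by its space of values.
\<close>

definition trans_ci ::
    "'t measure \<Rightarrow> ('t \<Rightarrow> 'w measure) \<Rightarrow>
     'x measure \<Rightarrow> ('w \<times> 't \<Rightarrow> 'x measure) \<Rightarrow>
     'y measure \<Rightarrow> ('w \<times> 't \<Rightarrow> 'y measure) \<Rightarrow>
     'z measure \<Rightarrow> ('w \<times> 't \<Rightarrow> 'z measure) \<Rightarrow> bool" where
  "trans_ci T K \<X> X \<Y> Y \<Z> Z \<longleftrightarrow>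
     (\<exists>Q. markov_kernel \<Z> \<X> Q \<and>
       (\<forall>t\<in>space T.
          joint_kernel K (X \<Otimes>\<^sub>K Y \<Otimes>\<^sub>K Z) t =
          kernel_prod (\<Y> \<Otimes>\<^sub>M \<Z>) (\<lambda>((y, z), t). Q z)
            (snd_marginal (\<Y> \<Otimes>\<^sub>M \<Z>) (joint_kernel K (X \<Otimes>\<^sub>K Y \<Otimes>\<^sub>K Z))) t))"

text \<open>\<open>determined_by T K \<X> X \<Z> Z\<close> is the relation \<open>X \<precsim> Z\<close> with respect to \<open>K\<close>.\<close>

definition determined_by ::
    "'t measure \<Rightarrow> ('t \<Rightarrow> 'w measure) \<Rightarrow>
     'x measure \<Rightarrow> ('w \<times> 't \<Rightarrow> 'x measure) \<Rightarrow>
     'z measure \<Rightarrow> ('w \<times> 't \<Rightarrow> 'z measure) \<Rightarrow> bool" where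
  "determined_by T K \<X> X \<Z> Z \<longleftrightarrow>
     (\<exists>\<phi>. \<phi> \<in> \<Z> \<rightarrow>\<^sub>M \<X> \<and>
       (\<forall>t\<in>space T.
          joint_kernel K (X \<Otimes>\<^sub>K Z) t =
          kernel_prod \<Z> (\<lambda>(z, t). return \<X> (\<phi> z))
            (snd_marginal \<Z> (joint_kernel K (X \<Otimes>\<^sub>K Z))) t))"

definition disintegration_triple :: "'x measure \<Rightarrow> 'y measure \<Rightarrow> 'z measure \<Rightarrow> bool" where
  "disintegration_triple \<X> \<Y> \<Z> \<longleftrightarrow>
     (\<forall>K. markov_kernel \<Z> (\<X> \<Otimes>\<^sub>M \<Y>) K \<longrightarrow>
       (\<exists>L. markov_kernel (\<Y> \<Otimes>\<^sub>M \<Z>) \<X> L \<and>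
         (\<forall>z\<in>space \<Z>. K z = kernel_prod \<Y> L (snd_marginal \<Y> K) z)))"

end

theory Submission
  imports Defs
begin

text \<open>
  For a fixed input \<open>t\<close>, the joint kernel of \<open>X\<close>, \<open>Y\<close>, \<open>U\<close>, \<open>Z\<close> is a probability measure
  \<open>P t\<close> on the product of the four value spaces. On this space the four kernels become ordinary
  random variables, the coordinates \<open>x\<close>, \<open>y\<close>, \<open>u\<close>, \<open>z\<close>; the input variable becomes the
  constant \<open>t\<close>. All joint kernels that occur in the rules are images of \<open>P t\<close> under
  tuples of coordinates, so marginalisation and reordering of factors are invisible at
  this level (\<open>coordinate_laws\<close>, \<open>joint_kernel_distr\<close>). Transitional conditional
  independence of \<open>X\<close> from \<open>Y\<close> given \<open>Z\<close> says that one kernel \<open>Q\<close>, the same for all \<open>t\<close>, is such that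
  \<open>Q (z)\<close> is the conditional law of \<open>x\<close> given \<open>(y, z)\<close> under every \<open>P t\<close>
  (\<open>trans_ci_iff_conditional_law\<close>).

  The rules then follow from a few facts about conditional laws on one probability space. In each
  rule a single new kernel is built for all \<open>t\<close>, and only its defining property is checked for
  each \<open>t\<close>.

  \<^item> A conditional law given \<open>s\<close> that depends on \<open>s\<close> only through \<open>g (s)\<close> is also the conditional law
    given \<open>g (s)\<close> (\<open>conditional_law_coarsen\<close>). This gives right decomposition and right
    weak union; as \<open>t\<close> is constant it also allows \<open>T\<close> to be added to the condition, which gives the
    inverted right decomposition and, with the disintegration, the restricted right redundancy.
  \<^item> Conditional laws can be pushed forward (left decomposition), disintegrated
    (left weak union) and composed (left contraction).
  \<^item> A Dirac conditional law means equality of events up to null sets, and this persists under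
    any further conditioning (left redundancy).
  \<^item> Conditional laws are almost surely unique, so a kernel for \<open>x\<close> given \<open>(u, z)\<close> that uses
    only \<open>z\<close> may replace any other kernel for \<open>x\<close> given \<open>(u, z)\<close> (right contraction).
  \<^item> Conditional independence is symmetric as soon as a conditional law is known on
    both sides (\<open>conditional_law_symmetric\<close>). Given \<open>(u, z)\<close> this turns the law of \<open>y\<close> into a
    law that ignores \<open>x\<close> (flipped left cross contraction). For the right cross contraction, composing the
    kernel of \<open>x\<close> given \<open>(u, z)\<close> with that of \<open>u\<close> given \<open>z\<close> supplies the missing law of \<open>x\<close>
    given \<open>z\<close>; symmetry then reduces the rule to right contraction.
\<close>

section \<open>Conditional laws of random variables\<close>

text \<open>
  The measure equation is the one in \<^const>\<open>kernel_prod\<close> for a single input, written for random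
  variables instead of a measure on a product. In this form a change of the conditioning variable is
  a change of the function \<open>s\<close> and needs no new measure.
\<close>

definition conditional_law ::
    "'w measure \<Rightarrow> 'x measure \<Rightarrow> ('w \<Rightarrow> 'x) \<Rightarrow> 's measure \<Rightarrow> ('w \<Rightarrow> 's) \<Rightarrow> ('s \<Rightarrow> 'x measure) \<Rightarrow> bool"
  where
  "conditional_law M \<X> x S s L \<longleftrightarrow>
     x \<in> M \<rightarrow>\<^sub>M \<X> \<and> s \<in> M \<rightarrow>\<^sub>M S \<and> markov_kernel S \<X> L \<and>
     distr M (\<X> \<Otimes>\<^sub>M S) (\<lambda>\<omega>. (x \<omega>, s \<omega>)) = distr M S s \<bind> (\<lambda>\<sigma>. L \<sigma> \<Otimes>\<^sub>M return S \<sigma>)"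

lemma conditional_lawD:
  assumes "conditional_law M \<X> x S s L"
  shows "x \<in> M \<rightarrow>\<^sub>M \<X>" "s \<in> M \<rightarrow>\<^sub>M S" "markov_kernel S \<X> L"
  using assms by (auto simp: conditional_law_def)

lemma markov_kernelD:
  assumes "markov_kernel S M L" "\<sigma> \<in> space S"
  shows "sets (L \<sigma>) = sets M" "space (L \<sigma>) = space M" "prob_space (L \<sigma>)"
  using measurable_space[OF assms] sets_eq_imp_space_eq by (auto simp: space_prob_algebra)

lemma measurable_graph_kernel:
  assumes "markov_kernel S \<X> L"
  shows "markov_kernel S (\<X> \<Otimes>\<^sub>M S) (\<lambda>\<sigma>. L \<sigma> \<Otimes>\<^sub>M return S \<sigma>)"
  by (intro measurable_pair_prob assms measurable_return_prob_space)

lemma nn_integral_graph_kernel: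
  assumes L: "markov_kernel S \<X> L" and \<sigma>: "\<sigma> \<in> space S"
    and f: "f \<in> borel_measurable (\<X> \<Otimes>\<^sub>M S)"
  shows "(\<integral>\<^sup>+ p. f p \<partial>(L \<sigma> \<Otimes>\<^sub>M return S \<sigma>)) = (\<integral>\<^sup>+ a. f (a, \<sigma>) \<partial>L \<sigma>)"
proof -
  interpret R: prob_space "return S \<sigma>"
    using \<sigma> by (rule prob_space_return)
  have sL: "sets (L \<sigma>) = sets \<X>" "space (L \<sigma>) = space \<X>"
    using markov_kernelD[OF L \<sigma>] by auto
  have "f \<in> borel_measurable (L \<sigma> \<Otimes>\<^sub>M return S \<sigma>)"
    using f sL by (simp cong: measurable_cong_sets sets_pair_measure_cong)
  then have "(\<integral>\<^sup>+ p. f p \<partial>(L \<sigma> \<Otimes>\<^sub>M return S \<sigma>))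
      = (\<integral>\<^sup>+ a. \<integral>\<^sup>+ b. f (a, b) \<partial>return S \<sigma> \<partial>L \<sigma>)"
    by (simp add: R.nn_integral_fst)
  also have "\<dots> = (\<integral>\<^sup>+ a. f (a, \<sigma>) \<partial>L \<sigma>)"
    using \<sigma> f sL by (intro nn_integral_cong nn_integral_return) auto
  finally show ?thesis .
qed

lemma emeasure_Collect_eq_nn_integral:
  assumes "{\<omega> \<in> space M. Q \<omega>} \<in> sets M"
    and "\<And>\<omega>. \<omega> \<in> space M \<Longrightarrow> f \<omega> = (if Q \<omega> then 1 else 0)"
  shows "emeasure M {\<omega> \<in> space M. Q \<omega>} = (\<integral>\<^sup>+ \<omega>. f \<omega> \<partial>M)"
  using assms
  by (subst nn_integral_indicator[symmetric], simp)
     (intro nn_integral_cong, auto simp: indicator_def)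

lemma measurable_kernel_integral:
  assumes L: "markov_kernel S \<X> L" and f: "f \<in> borel_measurable (\<X> \<Otimes>\<^sub>M S)"
  shows "(\<lambda>\<sigma>. \<integral>\<^sup>+ a. f (a, \<sigma>) \<partial>L \<sigma>) \<in> borel_measurable S"
proof -
  have "(\<lambda>(\<sigma>, a). f (a, \<sigma>)) \<in> borel_measurable (S \<Otimes>\<^sub>M \<X>)"
    using f by measurable
  then show ?thesis
    by (rule nn_integral_measurable_subprob_algebra2[OF _ measurable_prob_algebraD[OF L]])
qed

lemma measurable_kernel_emeasure:
  assumes "markov_kernel S \<X> L" "A \<in> sets \<X>"
  shows "(\<lambda>\<sigma>. emeasure (L \<sigma>) A) \<in> borel_measurable S"
  using measurable_emeasure_kernel[OF measurable_prob_algebraD] assms by blast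

text \<open>
  The defining property in the form of a tower rule. Its use in both directions, for functions that are
  not products, carries all the computations below.
\<close>

lemma nn_integral_conditional_law:
  assumes c: "conditional_law M \<X> x S s L" and f: "f \<in> borel_measurable (\<X> \<Otimes>\<^sub>M S)"
  shows "(\<integral>\<^sup>+ \<omega>. f (x \<omega>, s \<omega>) \<partial>M) = (\<integral>\<^sup>+ \<omega>. \<integral>\<^sup>+ a. f (a, s \<omega>) \<partial>L (s \<omega>) \<partial>M)"
proof -
  note [measurable] = conditional_lawD(1,2)[OF c] f
  have L: "markov_kernel S \<X> L"
    using conditional_lawD(3)[OF c] .
  have g: "(\<lambda>\<sigma>. L \<sigma> \<Otimes>\<^sub>M return S \<sigma>) \<in> distr M S s \<rightarrow>\<^sub>M subprob_algebra (\<X> \<Otimes>\<^sub>M S)"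
    using measurable_prob_algebraD[OF measurable_graph_kernel[OF L]] by simp
  have "(\<integral>\<^sup>+ \<omega>. f (x \<omega>, s \<omega>) \<partial>M) = (\<integral>\<^sup>+ p. f p \<partial>distr M (\<X> \<Otimes>\<^sub>M S) (\<lambda>\<omega>. (x \<omega>, s \<omega>)))"
    by (simp add: nn_integral_distr)
  also have "\<dots> = (\<integral>\<^sup>+ p. f p \<partial>(distr M S s \<bind> (\<lambda>\<sigma>. L \<sigma> \<Otimes>\<^sub>M return S \<sigma>)))"
    using c by (simp add: conditional_law_def)
  also have "\<dots> = (\<integral>\<^sup>+ \<sigma>. \<integral>\<^sup>+ p. f p \<partial>(L \<sigma> \<Otimes>\<^sub>M return S \<sigma>) \<partial>distr M S s)"
    by (rule nn_integral_bind[OF f g])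
  also have "\<dots> = (\<integral>\<^sup>+ \<sigma>. \<integral>\<^sup>+ a. f (a, \<sigma>) \<partial>L \<sigma> \<partial>distr M S s)"
    by (intro nn_integral_cong nn_integral_graph_kernel[OF L _ f]) simp
  also have "\<dots> = (\<integral>\<^sup>+ \<omega>. \<integral>\<^sup>+ a. f (a, s \<omega>) \<partial>L (s \<omega>) \<partial>M)"
    by (rule nn_integral_distr[OF conditional_lawD(2)[OF c]])
       (simp add: measurable_kernel_integral[OF L f])
  finally show ?thesis .
qed

lemma emeasure_conditional_law:
  assumes c: "conditional_law M \<X> x S s L" and A: "A \<in> sets \<X>" and E: "E \<in> sets S"
  shows "emeasure M {\<omega> \<in> space M. x \<omega> \<in> A \<and> s \<omega> \<in> E}
         = (\<integral>\<^sup>+ \<omega>. indicator E (s \<omega>) * emeasure (L (s \<omega>)) A \<partial>M)"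
proof -
  note [measurable] = conditional_lawD(1,2)[OF c] A E
  have "emeasure M {\<omega> \<in> space M. x \<omega> \<in> A \<and> s \<omega> \<in> E}
      = (\<integral>\<^sup>+ \<omega>. indicator (A \<times> E) (x \<omega>, s \<omega>) \<partial>M)"
  proof (rule emeasure_Collect_eq_nn_integral)
    show "{\<omega> \<in> space M. x \<omega> \<in> A \<and> s \<omega> \<in> E} \<in> sets M"
      by measurable
  qed (simp add: indicator_def)
  also have "\<dots> = (\<integral>\<^sup>+ \<omega>. \<integral>\<^sup>+ a. indicator (A \<times> E) (a, s \<omega>) \<partial>L (s \<omega>) \<partial>M)"
    by (rule nn_integral_conditional_law[OF c]) simp
  also have "\<dots> = (\<integral>\<^sup>+ \<omega>. indicator E (s \<omega>) * emeasure (L (s \<omega>)) A \<partial>M)"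
  proof (rule nn_integral_cong)
    fix \<omega> assume "\<omega> \<in> space M"
    then have "s \<omega> \<in> space S"
      using measurable_space[OF conditional_lawD(2)[OF c]] by simp
    then have "A \<in> sets (L (s \<omega>))"
      using markov_kernelD(1)[OF conditional_lawD(3)[OF c]] A by auto
    then show "(\<integral>\<^sup>+ a. indicator (A \<times> E) (a, s \<omega>) \<partial>L (s \<omega>))
        = indicator E (s \<omega>) * emeasure (L (s \<omega>)) A"
      by (simp add: indicator_times mult.commute[of _ "indicator E (s \<omega>)"] nn_integral_cmult)
  qed
  finally show ?thesis .
qed

text \<open>
  Rectangles form an intersection-stable generator of the product sigma-algebra, so conditional
  laws only have to be checked on them.
\<close>

lemma (in prob_space) conditional_lawI:
  assumes x: "x \<in> M \<rightarrow>\<^sub>M \<X>" and s: "s \<in> M \<rightarrow>\<^sub>M S" and L: "markov_kernel S \<X> L"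
    and eq: "\<And>A E. A \<in> sets \<X> \<Longrightarrow> E \<in> sets S \<Longrightarrow>
      emeasure M {\<omega> \<in> space M. x \<omega> \<in> A \<and> s \<omega> \<in> E}
      = (\<integral>\<^sup>+ \<omega>. indicator E (s \<omega>) * emeasure (L (s \<omega>)) A \<partial>M)"
  shows "conditional_law M \<X> x S s L"
proof -
  note [measurable] = x s
  let ?J = "distr M (\<X> \<Otimes>\<^sub>M S) (\<lambda>\<omega>. (x \<omega>, s \<omega>))"
  let ?R = "distr M S s \<bind> (\<lambda>\<sigma>. L \<sigma> \<Otimes>\<^sub>M return S \<sigma>)"
  have D: "distr M S s \<in> space (prob_algebra S)"
    by (simp add: space_prob_algebra prob_space_distr)
  note g = measurable_graph_kernel[OF L]
  have "?J = ?R"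
  proof (rule measure_eqI_generator_eq_countable[OF Int_stable_pair_measure_generator
        pair_measure_closed])
    fix X assume "X \<in> {a \<times> b |a b. a \<in> sets \<X> \<and> b \<in> sets S}"
    then obtain A E where X: "X = A \<times> E" and A[measurable]: "A \<in> sets \<X>" and E[measurable]: "E \<in> sets S"
      by auto
    have "emeasure ?J X = emeasure M {\<omega> \<in> space M. x \<omega> \<in> A \<and> s \<omega> \<in> E}"
      unfolding X by (subst emeasure_distr) (auto intro!: arg_cong[where f = "emeasure M"])
    also have "\<dots> = (\<integral>\<^sup>+ \<sigma>. indicator E \<sigma> * emeasure (L \<sigma>) A \<partial>distr M S s)"
      using measurable_kernel_emeasure[OF L A] by (simp add: eq[OF A E] nn_integral_distr)
    also have "\<dots> = (\<integral>\<^sup>+ \<sigma>. emeasure (L \<sigma> \<Otimes>\<^sub>M return S \<sigma>) (A \<times> E) \<partial>distr M S s)"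
    proof (rule nn_integral_cong)
      fix \<sigma> assume "\<sigma> \<in> space (distr M S s)"
      then have \<sigma>: "\<sigma> \<in> space S"
        by simp
      interpret R: prob_space "return S \<sigma>"
        using \<sigma> by (rule prob_space_return)
      show "indicator E \<sigma> * emeasure (L \<sigma>) A = emeasure (L \<sigma> \<Otimes>\<^sub>M return S \<sigma>) (A \<times> E)"
        using markov_kernelD(1)[OF L \<sigma>] 
        by (subst R.emeasure_pair_measure_Times) (auto simp: mult.commute)
    qed
    also have "\<dots> = emeasure ?R X"
      unfolding X by (rule emeasure_bind_prob_algebra[OF D g, symmetric]) simp
    finally show "emeasure ?J X = emeasure ?R X" .
  next
    show "sets ?R = sigma_sets (space \<X> \<times> space S) {a \<times> b |a b. a \<in> sets \<X> \<and> b \<in> sets S}"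
      using sets_bind'[OF D g] by (simp add: sets_pair_measure)
    show "emeasure ?J X \<noteq> \<infinity>" for X
      unfolding infinity_ennreal_def
      by (intro finite_measure.emeasure_finite prob_space.finite_measure prob_space_distr) measurable
    show "{space \<X> \<times> space S} \<subseteq> {a \<times> b |a b. a \<in> sets \<X> \<and> b \<in> sets S}"
      by auto
  qed (auto simp: sets_pair_measure)
  then show ?thesis
    using x s L by (simp add: conditional_law_def)
qed

section \<open>Calculus of conditional laws\<close>

text \<open>
  An event about \<open>s' = g (s)\<close> is an event about \<open>s\<close>, and the integrand \<open>L (s) = L' (g (s))\<close> is
  already a function of \<open>s'\<close>. The map \<open>g\<close> may also add constants or regroup tuples.
\<close>

lemma (in prob_space) conditional_law_coarsen:
  assumes c: "conditional_law M \<X> x S s L"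
    and g: "g \<in> S \<rightarrow>\<^sub>M S'" and L': "markov_kernel S' \<X> L'"
    and eq: "\<And>\<sigma>. \<sigma> \<in> space S \<Longrightarrow> L \<sigma> = L' (g \<sigma>)"
    and s': "\<And>\<omega>. \<omega> \<in> space M \<Longrightarrow> s' \<omega> = g (s \<omega>)"
  shows "conditional_law M \<X> x S' s' L'"
proof (rule conditional_lawI)
  note s = conditional_lawD(2)[OF c]
  have "(\<lambda>\<omega>. g (s \<omega>)) \<in> M \<rightarrow>\<^sub>M S'"
    using g s by measurable
  then show "s' \<in> M \<rightarrow>\<^sub>M S'"
    using s' by (simp cong: measurable_cong)
  fix A E assume A: "A \<in> sets \<X>" and E: "E \<in> sets S'"
  have gE: "g -` E \<inter> space S \<in> sets S"
    using g E by measurable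
  have sp: "\<omega> \<in> space M \<Longrightarrow> s \<omega> \<in> space S" for \<omega>
    using s by (simp add: measurable_space)
  have "emeasure M {\<omega> \<in> space M. x \<omega> \<in> A \<and> s' \<omega> \<in> E}
      = emeasure M {\<omega> \<in> space M. x \<omega> \<in> A \<and> s \<omega> \<in> g -` E \<inter> space S}"
    using s' sp by (intro arg_cong[where f = "emeasure M"]) auto
  also have "\<dots> = (\<integral>\<^sup>+ \<omega>. indicator (g -` E \<inter> space S) (s \<omega>) * emeasure (L (s \<omega>)) A \<partial>M)"
    by (rule emeasure_conditional_law[OF c A gE])
  also have "\<dots> = (\<integral>\<^sup>+ \<omega>. indicator E (s' \<omega>) * emeasure (L' (s' \<omega>)) A \<partial>M)"
    using s' sp eq by (intro nn_integral_cong) (auto split: split_indicator)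
  finally show "emeasure M {\<omega> \<in> space M. x \<omega> \<in> A \<and> s' \<omega> \<in> E}
      = (\<integral>\<^sup>+ \<omega>. indicator E (s' \<omega>) * emeasure (L' (s' \<omega>)) A \<partial>M)" .
qed (use conditional_lawD[OF c] L' in auto)

lemma (in prob_space) conditional_law_map:
  assumes c: "conditional_law M \<X> x S s L" and h: "h \<in> \<X> \<rightarrow>\<^sub>M \<X>'"
  shows "conditional_law M \<X>' (\<lambda>\<omega>. h (x \<omega>)) S s (\<lambda>\<sigma>. distr (L \<sigma>) \<X>' h)"
proof (rule conditional_lawI)
  note x = conditional_lawD(1)[OF c] and s = conditional_lawD(2)[OF c]
    and L = conditional_lawD(3)[OF c]
  show "(\<lambda>\<omega>. h (x \<omega>)) \<in> M \<rightarrow>\<^sub>M \<X>'"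
    using x h by measurable
  show "markov_kernel S \<X>' (\<lambda>\<sigma>. distr (L \<sigma>) \<X>' h)"
    using measurable_compose[OF L measurable_distr_prob_space[OF h]] .
  fix A E assume A: "A \<in> sets \<X>'" and E: "E \<in> sets S"
  have hA: "h -` A \<inter> space \<X> \<in> sets \<X>"
    using h A by measurable
  have "emeasure M {\<omega> \<in> space M. h (x \<omega>) \<in> A \<and> s \<omega> \<in> E}
      = emeasure M {\<omega> \<in> space M. x \<omega> \<in> h -` A \<inter> space \<X> \<and> s \<omega> \<in> E}"
    using measurable_space[OF x] by (intro arg_cong[where f = "emeasure M"]) auto
  also have "\<dots> = (\<integral>\<^sup>+ \<omega>. indicator E (s \<omega>) * emeasure (L (s \<omega>)) (h -` A \<inter> space \<X>) \<partial>M)"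
    by (rule emeasure_conditional_law[OF c hA E])
  also have "\<dots> = (\<integral>\<^sup>+ \<omega>. indicator E (s \<omega>) * emeasure (distr (L (s \<omega>)) \<X>' h) A \<partial>M)"
  proof (rule nn_integral_cong)
    fix \<omega> assume "\<omega> \<in> space M"
    then have *: "sets (L (s \<omega>)) = sets \<X>" "space (L (s \<omega>)) = space \<X>"
      using markov_kernelD(1,2)[OF L] measurable_space[OF s] by auto
    have "h \<in> L (s \<omega>) \<rightarrow>\<^sub>M \<X>'"
      using h * by (simp cong: measurable_cong_sets)
    then show "indicator E (s \<omega>) * emeasure (L (s \<omega>)) (h -` A \<inter> space \<X>)
        = indicator E (s \<omega>) * emeasure (distr (L (s \<omega>)) \<X>' h) A"
      using A * by (simp add: emeasure_distr)
  qed
  finally show "emeasure M {\<omega> \<in> space M. h (x \<omega>) \<in> A \<and> s \<omega> \<in> E}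
      = (\<integral>\<^sup>+ \<omega>. indicator E (s \<omega>) * emeasure (distr (L (s \<omega>)) \<X>' h) A \<partial>M)" .
qed (rule conditional_lawD(2)[OF c])

text \<open>
  If the conditional law of \<open>x\<close> given \<open>z\<close> is the point mass at \<open>\<phi> (z)\<close>, then for each measurable
  \<open>A\<close> the events that \<open>x\<close> lies in \<open>A\<close> and that \<open>\<phi> (z)\<close> lies in \<open>A\<close> differ by a null set. Replacing
  one by the other is then harmless in the presence of any further variable. The argument is made
  for one set \<open>A\<close> at a time, because in a general measurable space \<open>x = \<phi> (z)\<close> need not be an event.
\<close>

lemma (in prob_space) conditional_law_dirac_refine:
  assumes c: "conditional_law M \<X> x \<Z> z (\<lambda>c. return \<X> (\<phi> c))"
    and \<phi>: "\<phi> \<in> \<Z> \<rightarrow>\<^sub>M \<X>" and g: "g \<in> S \<rightarrow>\<^sub>M \<Z>" and s: "s \<in> M \<rightarrow>\<^sub>M S"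
    and z: "\<And>\<omega>. \<omega> \<in> space M \<Longrightarrow> z \<omega> = g (s \<omega>)"
  shows "conditional_law M \<X> x S s (\<lambda>\<sigma>. return \<X> (\<phi> (g \<sigma>)))"
proof (rule conditional_lawI)
  show x: "x \<in> M \<rightarrow>\<^sub>M \<X>"
    using conditional_lawD(1)[OF c] .
  note zm = conditional_lawD(2)[OF c]
  note [measurable] = x s g \<phi> zm
  show "markov_kernel S \<X> (\<lambda>\<sigma>. return \<X> (\<phi> (g \<sigma>)))"
    by measurable
  fix A E assume A[measurable]: "A \<in> sets \<X>" and E[measurable]: "E \<in> sets S"
  have null: "emeasure M {\<omega> \<in> space M. x \<omega> \<in> B \<and> z \<omega> \<in> \<phi> -` C \<inter> space \<Z>} = 0"
    if [measurable]: "B \<in> sets \<X>" "C \<in> sets \<X>" and disj: "B \<inter> C = {}" for B C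
  proof -
    have "emeasure M {\<omega> \<in> space M. x \<omega> \<in> B \<and> z \<omega> \<in> \<phi> -` C \<inter> space \<Z>}
        = (\<integral>\<^sup>+ \<omega>. indicator (\<phi> -` C \<inter> space \<Z>) (z \<omega>) * emeasure (return \<X> (\<phi> (z \<omega>))) B \<partial>M)"
      by (rule emeasure_conditional_law[OF c]) measurable
    also have "\<dots> = (\<integral>\<^sup>+ \<omega>. 0 \<partial>M)"
      using disj by (intro nn_integral_cong) (auto split: split_indicator)
    finally show ?thesis
      by simp
  qed
  have "AE \<omega> in M. \<not> (x \<omega> \<in> A \<and> z \<omega> \<in> \<phi> -` (space \<X> - A) \<inter> space \<Z>)"
    by (rule AE_I[OF _ null[of A "space \<X> - A"]]) auto
  moreover have "AE \<omega> in M. \<not> (x \<omega> \<in> space \<X> - A \<and> z \<omega> \<in> \<phi> -` A \<inter> space \<Z>)"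
    by (rule AE_I[OF _ null[of "space \<X> - A" A]]) auto
  ultimately have ae: "AE \<omega> in M. x \<omega> \<in> A \<longleftrightarrow> \<phi> (z \<omega>) \<in> A"
    using AE_space
  proof eventually_elim
    case (elim \<omega>)
    then show ?case
      using measurable_space[OF x] measurable_space[OF zm] measurable_space[OF \<phi>] by auto
  qed
  have "emeasure M {\<omega> \<in> space M. x \<omega> \<in> A \<and> s \<omega> \<in> E}
      = (\<integral>\<^sup>+ \<omega>. indicator A (x \<omega>) * indicator E (s \<omega>) \<partial>M)"
    by (rule emeasure_Collect_eq_nn_integral) (measurable, auto split: split_indicator)
  also have "\<dots> = (\<integral>\<^sup>+ \<omega>. indicator E (s \<omega>) * emeasure (return \<X> (\<phi> (g (s \<omega>)))) A \<partial>M)"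
  proof (rule nn_integral_cong_AE)
    show "AE \<omega> in M. indicator A (x \<omega>) * indicator E (s \<omega>)
        = (indicator E (s \<omega>) * emeasure (return \<X> (\<phi> (g (s \<omega>)))) A :: ennreal)"
      using ae AE_space by eventually_elim (auto simp: z split: split_indicator)
  qed
  finally show "emeasure M {\<omega> \<in> space M. x \<omega> \<in> A \<and> s \<omega> \<in> E}
      = (\<integral>\<^sup>+ \<omega>. indicator E (s \<omega>) * emeasure (return \<X> (\<phi> (g (s \<omega>)))) A \<partial>M)" .
qed (rule s)

text \<open>
  For each value \<open>\<sigma>\<close> the measure \<open>J \<sigma>\<close> is itself a probability space on which the two projections are random
  variables. Disintegrating inside every \<open>J \<sigma>\<close> and integrating over \<open>\<sigma>\<close> gives the law of
  \<open>x\<close> given \<open>(u, s)\<close>.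
\<close>

lemma (in prob_space) conditional_law_disintegrate:
  assumes c: "conditional_law M (\<X> \<Otimes>\<^sub>M \<U>) (\<lambda>\<omega>. (x \<omega>, u \<omega>)) S s J"
    and L: "markov_kernel (\<U> \<Otimes>\<^sub>M S) \<X> L"
    and dis: "\<And>\<sigma>. \<sigma> \<in> space S \<Longrightarrow> conditional_law (J \<sigma>) \<X> fst \<U> snd (\<lambda>b. L (b, \<sigma>))"
  shows "conditional_law M \<X> x (\<U> \<Otimes>\<^sub>M S) (\<lambda>\<omega>. (u \<omega>, s \<omega>)) L"
proof (rule conditional_lawI[OF _ _ L])
  note xu[measurable] = conditional_lawD(1)[OF c] and s[measurable] = conditional_lawD(2)[OF c]
    and J = conditional_lawD(3)[OF c]
  show x[measurable]: "x \<in> M \<rightarrow>\<^sub>M \<X>"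
    using measurable_compose[OF xu measurable_fst] by simp
  have u[measurable]: "u \<in> M \<rightarrow>\<^sub>M \<U>"
    using measurable_compose[OF xu measurable_snd] by simp
  show us: "(\<lambda>\<omega>. (u \<omega>, s \<omega>)) \<in> M \<rightarrow>\<^sub>M \<U> \<Otimes>\<^sub>M S"
    by measurable
  fix A E assume A[measurable]: "A \<in> sets \<X>" and E[measurable]: "E \<in> sets (\<U> \<Otimes>\<^sub>M S)"
  have LA[measurable]: "(\<lambda>p. emeasure (L p) A) \<in> borel_measurable (\<U> \<Otimes>\<^sub>M S)"
    by (rule measurable_kernel_emeasure[OF L A])
  let ?f = "\<lambda>p. indicator A (fst (fst p)) * indicator E (snd (fst p), snd p) :: ennreal"
  let ?g = "\<lambda>p. indicator E (snd (fst p), snd p) * emeasure (L (snd (fst p), snd p)) A"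
  have "emeasure M {\<omega> \<in> space M. x \<omega> \<in> A \<and> (u \<omega>, s \<omega>) \<in> E}
      = (\<integral>\<^sup>+ \<omega>. ?f ((x \<omega>, u \<omega>), s \<omega>) \<partial>M)"
    by (rule emeasure_Collect_eq_nn_integral) (measurable, auto split: split_indicator)
  also have "\<dots> = (\<integral>\<^sup>+ \<omega>. \<integral>\<^sup>+ p. ?f (p, s \<omega>) \<partial>J (s \<omega>) \<partial>M)"
    by (rule nn_integral_conditional_law[OF c]) measurable
  also have "\<dots> = (\<integral>\<^sup>+ \<omega>. \<integral>\<^sup>+ p. ?g (p, s \<omega>) \<partial>J (s \<omega>) \<partial>M)"
  proof (rule nn_integral_cong)
    fix \<omega> assume "\<omega> \<in> space M"
    then have \<sigma>: "s \<omega> \<in> space S"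
      using measurable_space[OF s] by auto
    let ?E = "{b \<in> space \<U>. (b, s \<omega>) \<in> E}"
    have E': "?E \<in> sets \<U>"
      using \<sigma> by measurable
    have spJ: "space (J (s \<omega>)) = space \<X> \<times> space \<U>" and sJ: "sets (J (s \<omega>)) = sets (\<X> \<Otimes>\<^sub>M \<U>)"
      using markov_kernelD[OF J \<sigma>] by (auto simp: space_pair_measure)
    have "{p \<in> space (J (s \<omega>)). fst p \<in> A \<and> snd p \<in> ?E} = A \<times> ?E"
      using sets.sets_into_space[OF A] by (auto simp: spJ)
    then have "{p \<in> space (J (s \<omega>)). fst p \<in> A \<and> snd p \<in> ?E} \<in> sets (J (s \<omega>))"
      using E' by (simp add: sJ)
    then have "(\<integral>\<^sup>+ p. ?f (p, s \<omega>) \<partial>J (s \<omega>))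
        = emeasure (J (s \<omega>)) {p \<in> space (J (s \<omega>)). fst p \<in> A \<and> snd p \<in> ?E}"
      by (rule emeasure_Collect_eq_nn_integral[symmetric]) (auto simp: spJ split: split_indicator)
    also have "\<dots> = (\<integral>\<^sup>+ p. indicator ?E (snd p) * emeasure (L (snd p, s \<omega>)) A \<partial>J (s \<omega>))"
      by (rule emeasure_conditional_law[OF dis[OF \<sigma>] A E'])
    also have "\<dots> = (\<integral>\<^sup>+ p. ?g (p, s \<omega>) \<partial>J (s \<omega>))"
      by (intro nn_integral_cong) (auto simp: spJ split: split_indicator)
    finally show "(\<integral>\<^sup>+ p. ?f (p, s \<omega>) \<partial>J (s \<omega>)) = \<dots>" .
  qed
  also have "\<dots> = (\<integral>\<^sup>+ \<omega>. ?g ((x \<omega>, u \<omega>), s \<omega>) \<partial>M)"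
    by (rule nn_integral_conditional_law[OF c, symmetric]) measurable
  finally show "emeasure M {\<omega> \<in> space M. x \<omega> \<in> A \<and> (u \<omega>, s \<omega>) \<in> E}
      = (\<integral>\<^sup>+ \<omega>. indicator E (u \<omega>, s \<omega>) * emeasure (L (u \<omega>, s \<omega>)) A \<partial>M)"
    by simp
qed

lemma measurable_chain_kernel:
  assumes L: "markov_kernel (\<U> \<Otimes>\<^sub>M S) \<X> L" and N: "markov_kernel S \<U> N"
  shows "markov_kernel S (\<X> \<Otimes>\<^sub>M \<U>) (\<lambda>\<sigma>. N \<sigma> \<bind> (\<lambda>b. L (b, \<sigma>) \<Otimes>\<^sub>M return \<U> b))"
proof (rule measurable_bind_prob_space2[OF N])
  have 1: "(\<lambda>p. L (snd p, fst p)) \<in> S \<Otimes>\<^sub>M \<U> \<rightarrow>\<^sub>M prob_algebra \<X>"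
    by (rule measurable_compose[OF _ L]) measurable
  have 2: "(\<lambda>p. return \<U> (snd p)) \<in> S \<Otimes>\<^sub>M \<U> \<rightarrow>\<^sub>M prob_algebra \<U>"
    by (rule measurable_compose[OF measurable_snd measurable_return_prob_space])
  show "(\<lambda>(\<sigma>, b). L (b, \<sigma>) \<Otimes>\<^sub>M return \<U> b) \<in> S \<Otimes>\<^sub>M \<U> \<rightarrow>\<^sub>M prob_algebra (\<X> \<Otimes>\<^sub>M \<U>)"
    using measurable_pair_prob[OF 1 2] by (simp add: case_prod_beta')
qed

text \<open>
  The converse of the disintegration: integrate out \<open>x\<close> given \<open>(u, s)\<close>, then \<open>u\<close> given \<open>s\<close>.
\<close>

lemma (in prob_space) conditional_law_chain:
  assumes cx: "conditional_law M \<X> x (\<U> \<Otimes>\<^sub>M S) (\<lambda>\<omega>. (u \<omega>, s \<omega>)) L"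
    and cu: "conditional_law M \<U> u S s N"
  shows "conditional_law M (\<X> \<Otimes>\<^sub>M \<U>) (\<lambda>\<omega>. (x \<omega>, u \<omega>)) S s
           (\<lambda>\<sigma>. N \<sigma> \<bind> (\<lambda>b. L (b, \<sigma>) \<Otimes>\<^sub>M return \<U> b))"
proof (rule conditional_lawI)
  note [measurable] = conditional_lawD(1)[OF cx] conditional_lawD(1)[OF cu]
  note s[measurable] = conditional_lawD(2)[OF cu]
  note L = conditional_lawD(3)[OF cx] and N = conditional_lawD(3)[OF cu]
  show "(\<lambda>\<omega>. (x \<omega>, u \<omega>)) \<in> M \<rightarrow>\<^sub>M \<X> \<Otimes>\<^sub>M \<U>" "s \<in> M \<rightarrow>\<^sub>M S"
    by measurable
  show "markov_kernel S (\<X> \<Otimes>\<^sub>M \<U>) (\<lambda>\<sigma>. N \<sigma> \<bind> (\<lambda>b. L (b, \<sigma>) \<Otimes>\<^sub>M return \<U> b))"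
    by (rule measurable_chain_kernel[OF L N])
  fix A E assume A[measurable]: "A \<in> sets (\<X> \<Otimes>\<^sub>M \<U>)" and E[measurable]: "E \<in> sets S"
  let ?f = "\<lambda>(a, b, \<sigma>). indicator A (a, b) * indicator E \<sigma> :: ennreal"
  let ?h = "\<lambda>(b, \<sigma>). \<integral>\<^sup>+ a. ?f (a, b, \<sigma>) \<partial>L (b, \<sigma>)"
  have f: "?f \<in> borel_measurable (\<X> \<Otimes>\<^sub>M (\<U> \<Otimes>\<^sub>M S))"
    by measurable
  have h: "?h \<in> borel_measurable (\<U> \<Otimes>\<^sub>M S)"
    using measurable_kernel_integral[OF L f] by (simp add: case_prod_beta')
  have "emeasure M {\<omega> \<in> space M. (x \<omega>, u \<omega>) \<in> A \<and> s \<omega> \<in> E}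
      = (\<integral>\<^sup>+ \<omega>. ?f (x \<omega>, u \<omega>, s \<omega>) \<partial>M)"
    by (rule emeasure_Collect_eq_nn_integral) (measurable, auto split: split_indicator)
  also have "\<dots> = (\<integral>\<^sup>+ \<omega>. ?h (u \<omega>, s \<omega>) \<partial>M)"
    using nn_integral_conditional_law[OF cx f] by simp
  also have "\<dots> = (\<integral>\<^sup>+ \<omega>. \<integral>\<^sup>+ b. ?h (b, s \<omega>) \<partial>N (s \<omega>) \<partial>M)"
    by (rule nn_integral_conditional_law[OF cu h])
  also have "\<dots> = (\<integral>\<^sup>+ \<omega>. indicator E (s \<omega>) *
      emeasure (N (s \<omega>) \<bind> (\<lambda>b. L (b, s \<omega>) \<Otimes>\<^sub>M return \<U> b)) A \<partial>M)"
  proof (rule nn_integral_cong)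
    fix \<omega> assume "\<omega> \<in> space M"
    then have \<sigma>: "s \<omega> \<in> space S"
      using measurable_space[OF s] by auto
    have Ls: "markov_kernel \<U> \<X> (\<lambda>b. L (b, s \<omega>))"
      using measurable_compose[OF measurable_Pair2'[OF \<sigma>] L] by (simp add: comp_def)
    note sN = markov_kernelD[OF N \<sigma>]
    have ind: "indicator A \<in> borel_measurable (\<X> \<Otimes>\<^sub>M \<U>)"
      by measurable
    have A': "(\<lambda>a. indicator A (a, b) :: ennreal) \<in> borel_measurable (L (b, s \<omega>))" if "b \<in> space \<U>" for b
      using markov_kernelD(1)[OF Ls that] that by (simp cong: measurable_cong_sets)
    have "emeasure (N (s \<omega>) \<bind> (\<lambda>b. L (b, s \<omega>) \<Otimes>\<^sub>M return \<U> b)) A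
        = (\<integral>\<^sup>+ b. emeasure (L (b, s \<omega>) \<Otimes>\<^sub>M return \<U> b) A \<partial>N (s \<omega>))"
      by (rule emeasure_bind_prob_algebra[OF measurable_space[OF N \<sigma>] measurable_graph_kernel[OF Ls] A])
    also have "\<dots> = (\<integral>\<^sup>+ b. \<integral>\<^sup>+ a. indicator A (a, b) \<partial>L (b, s \<omega>) \<partial>N (s \<omega>))"
    proof (rule nn_integral_cong)
      fix b assume "b \<in> space (N (s \<omega>))"
      then have b: "b \<in> space \<U>"
        by (simp add: sN)
      have "A \<in> sets (L (b, s \<omega>) \<Otimes>\<^sub>M return \<U> b)"
        using markov_kernelD(1)[OF measurable_graph_kernel[OF Ls] b] A by simp
      then show "emeasure (L (b, s \<omega>) \<Otimes>\<^sub>M return \<U> b) A = (\<integral>\<^sup>+ a. indicator A (a, b) \<partial>L (b, s \<omega>))"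
        using nn_integral_graph_kernel[OF Ls b ind] by simp
    qed
    finally have *: "emeasure (N (s \<omega>) \<bind> (\<lambda>b. L (b, s \<omega>) \<Otimes>\<^sub>M return \<U> b)) A = \<dots>" .
    show "(\<integral>\<^sup>+ b. ?h (b, s \<omega>) \<partial>N (s \<omega>)) = indicator E (s \<omega>) *
        emeasure (N (s \<omega>) \<bind> (\<lambda>b. L (b, s \<omega>) \<Otimes>\<^sub>M return \<U> b)) A"
      unfolding * by (cases "s \<omega> \<in> E") simp_all
  qed
  finally show "emeasure M {\<omega> \<in> space M. (x \<omega>, u \<omega>) \<in> A \<and> s \<omega> \<in> E}
      = (\<integral>\<^sup>+ \<omega>. indicator E (s \<omega>) * emeasure (N (s \<omega>) \<bind> (\<lambda>b. L (b, s \<omega>) \<Otimes>\<^sub>M return \<U> b)) A \<partial>M)" .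
qed

text \<open>
  Both functions are densities, with respect to the law of \<open>s\<close>, of the finite measure that sends \<open>E\<close> to the
  probability of \<open>x \<in> A\<close> and \<open>s \<in> E\<close>. The exceptional null set depends on \<open>A\<close>, as the
  sigma-algebra of \<open>\<X>\<close> need not be countably generated.
\<close>

lemma (in prob_space) conditional_law_unique:
  assumes c: "conditional_law M \<X> x S s L" and c': "conditional_law M \<X> x S s L'"
    and A: "A \<in> sets \<X>"
  shows "AE \<omega> in M. emeasure (L (s \<omega>)) A = emeasure (L' (s \<omega>)) A"
proof -
  note s[measurable] = conditional_lawD(2)[OF c]
  have LA[measurable]: "(\<lambda>\<sigma>. emeasure (L \<sigma>) A) \<in> borel_measurable S"
      "(\<lambda>\<sigma>. emeasure (L' \<sigma>) A) \<in> borel_measurable S"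
    using conditional_lawD(3)[OF c] conditional_lawD(3)[OF c'] A
    by (auto intro: measurable_kernel_emeasure)
  let ?D = "distr M S s"
  interpret D: prob_space ?D
    by (rule prob_space_distr) measurable
  have "density ?D (\<lambda>\<sigma>. emeasure (L \<sigma>) A) = density ?D (\<lambda>\<sigma>. emeasure (L' \<sigma>) A)"
  proof (rule measure_eqI)
    fix E assume "E \<in> sets (density ?D (\<lambda>\<sigma>. emeasure (L \<sigma>) A))"
    then have E[measurable]: "E \<in> sets S"
      by simp
    show "emeasure (density ?D (\<lambda>\<sigma>. emeasure (L \<sigma>) A)) E
        = emeasure (density ?D (\<lambda>\<sigma>. emeasure (L' \<sigma>) A)) E"
      using emeasure_conditional_law[OF c A E] emeasure_conditional_law[OF c' A E]
      by (simp add: emeasure_density nn_integral_distr mult.commute)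
  qed simp
  then have "AE \<sigma> in ?D. emeasure (L \<sigma>) A = emeasure (L' \<sigma>) A"
    by (subst (asm) D.density_unique_iff) auto
  then show ?thesis
    by (subst (asm) AE_distr_iff) (auto simp: s)
qed

text \<open>
  Suppose the law of \<open>x\<close> given \<open>s\<close> depends only on \<open>s' = g (s)\<close>. Then any version \<open>L''\<close> of the
  law given \<open>s'\<close> may be used. This matters when \<open>L''\<close> has a better form, namely when it ignores
  part of \<open>s'\<close>.
\<close>

lemma (in prob_space) conditional_law_contract:
  assumes c: "conditional_law M \<X> x S s L"
    and g: "g \<in> S \<rightarrow>\<^sub>M S'" and L': "markov_kernel S' \<X> L'"
    and eq: "\<And>\<sigma>. \<sigma> \<in> space S \<Longrightarrow> L \<sigma> = L' (g \<sigma>)"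
    and s': "\<And>\<omega>. \<omega> \<in> space M \<Longrightarrow> s' \<omega> = g (s \<omega>)"
    and c': "conditional_law M \<X> x S' s' L''"
  shows "conditional_law M \<X> x S s (\<lambda>\<sigma>. L'' (g \<sigma>))"
proof (rule conditional_lawI)
  show "x \<in> M \<rightarrow>\<^sub>M \<X>" "s \<in> M \<rightarrow>\<^sub>M S"
    using conditional_lawD[OF c] by auto
  show "markov_kernel S \<X> (\<lambda>\<sigma>. L'' (g \<sigma>))"
    using measurable_compose[OF g conditional_lawD(3)[OF c']] .
  fix A E assume A: "A \<in> sets \<X>" and E: "E \<in> sets S"
  have "AE \<omega> in M. emeasure (L' (s' \<omega>)) A = emeasure (L'' (s' \<omega>)) A"
    by (rule conditional_law_unique[OF conditional_law_coarsen[OF c g L' eq s'] c' A])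
  then have "AE \<omega> in M. emeasure (L (s \<omega>)) A = emeasure (L'' (g (s \<omega>))) A"
    using AE_space
    by eventually_elim (use s' eq measurable_space[OF conditional_lawD(2)[OF c]] in auto)
  then have "(\<integral>\<^sup>+ \<omega>. indicator E (s \<omega>) * emeasure (L (s \<omega>)) A \<partial>M)
      = (\<integral>\<^sup>+ \<omega>. indicator E (s \<omega>) * emeasure (L'' (g (s \<omega>))) A \<partial>M)"
    by (intro nn_integral_cong_AE) auto
  then show "emeasure M {\<omega> \<in> space M. x \<omega> \<in> A \<and> s \<omega> \<in> E}
      = (\<integral>\<^sup>+ \<omega>. indicator E (s \<omega>) * emeasure (L'' (g (s \<omega>))) A \<partial>M)"
    using emeasure_conditional_law[OF c A E] by simp
qed

text \<open>
  Integrating out \<open>u\<close> given \<open>(x, z)\<close> turns the indicator of an event \<open>E\<close> about \<open>(u, z)\<close> into a function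
  \<open>h (z)\<close>. Then \<open>x\<close> can be integrated out given \<open>z\<close>, and \<open>h (z)\<close> is turned back into the indicator
  of \<open>E\<close> by the law of \<open>u\<close> given \<open>z\<close>. The law \<open>R\<close> of \<open>x\<close> given \<open>z\<close> has to be assumed, since on general
  measurable spaces it need not exist.
\<close>

lemma (in prob_space) conditional_law_symmetric:
  assumes cx: "conditional_law M \<X> x \<Z> z R"
    and cu: "conditional_law M \<U> u (\<X> \<Otimes>\<^sub>M \<Z>) (\<lambda>\<omega>. (x \<omega>, z \<omega>)) (\<lambda>\<sigma>. P (snd \<sigma>))"
    and P: "markov_kernel \<Z> \<U> P"
  shows "conditional_law M \<X> x (\<U> \<Otimes>\<^sub>M \<Z>) (\<lambda>\<omega>. (u \<omega>, z \<omega>)) (\<lambda>\<sigma>. R (snd \<sigma>))"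
proof (rule conditional_lawI)
  note x[measurable] = conditional_lawD(1)[OF cx] and z[measurable] = conditional_lawD(2)[OF cx]
    and R = conditional_lawD(3)[OF cx] and u[measurable] = conditional_lawD(1)[OF cu]
  show "x \<in> M \<rightarrow>\<^sub>M \<X>" "(\<lambda>\<omega>. (u \<omega>, z \<omega>)) \<in> M \<rightarrow>\<^sub>M \<U> \<Otimes>\<^sub>M \<Z>"
    by measurable
  show "markov_kernel (\<U> \<Otimes>\<^sub>M \<Z>) \<X> (\<lambda>\<sigma>. R (snd \<sigma>))"
    by (rule measurable_compose[OF measurable_snd R])
  have cu': "conditional_law M \<U> u \<Z> z P"
    by (rule conditional_law_coarsen[OF cu measurable_snd P]) auto
  fix A E assume A[measurable]: "A \<in> sets \<X>" and E[measurable]: "E \<in> sets (\<U> \<Otimes>\<^sub>M \<Z>)"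
  note RA[measurable] = measurable_kernel_emeasure[OF R A]
  define h where "h c = (\<integral>\<^sup>+ b. indicator E (b, c) \<partial>P c)" for c
  have h[measurable]: "h \<in> borel_measurable \<Z>"
    unfolding h_def by (rule measurable_kernel_integral[OF P]) measurable
  have mE: "(\<lambda>b. indicator E (b, c) :: ennreal) \<in> borel_measurable (P c)" if "c \<in> space \<Z>" for c
    using markov_kernelD(1)[OF P that] that by (simp cong: measurable_cong_sets)
  have zs: "\<omega> \<in> space M \<Longrightarrow> z \<omega> \<in> space \<Z>" for \<omega>
    using measurable_space[OF z] .
  have "emeasure M {\<omega> \<in> space M. x \<omega> \<in> A \<and> (u \<omega>, z \<omega>) \<in> E}
      = (\<integral>\<^sup>+ \<omega>. (\<lambda>(b, a, c). indicator A a * indicator E (b, c)) (u \<omega>, x \<omega>, z \<omega>) \<partial>M)"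
    by (rule emeasure_Collect_eq_nn_integral) (measurable, auto split: split_indicator)
  also have "\<dots> = (\<integral>\<^sup>+ \<omega>. \<integral>\<^sup>+ b. indicator A (x \<omega>) * indicator E (b, z \<omega>) \<partial>P (z \<omega>) \<partial>M)"
    using nn_integral_conditional_law[OF cu, of "\<lambda>(b, a, c). indicator A a * indicator E (b, c)"]
    by simp
  also have "\<dots> = (\<integral>\<^sup>+ \<omega>. (\<lambda>(a, c). indicator A a * h c) (x \<omega>, z \<omega>) \<partial>M)"
    by (intro nn_integral_cong) (simp add: nn_integral_cmult mE zs h_def)
  also have "\<dots> = (\<integral>\<^sup>+ \<omega>. \<integral>\<^sup>+ a. (\<lambda>(a, c). indicator A a * h c) (a, z \<omega>) \<partial>R (z \<omega>) \<partial>M)"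
    by (rule nn_integral_conditional_law[OF cx]) measurable
  also have "\<dots> = (\<integral>\<^sup>+ \<omega>. \<integral>\<^sup>+ b. (\<lambda>(b, c). emeasure (R c) A * indicator E (b, c)) (b, z \<omega>) \<partial>P (z \<omega>) \<partial>M)"
  proof (rule nn_integral_cong)
    fix \<omega> assume "\<omega> \<in> space M"
    then have c: "z \<omega> \<in> space \<Z>"
      by (rule zs)
    have "A \<in> sets (R (z \<omega>))"
      using markov_kernelD(1)[OF R c] A by simp
    then have "(\<integral>\<^sup>+ a. indicator A a * h (z \<omega>) \<partial>R (z \<omega>)) = emeasure (R (z \<omega>)) A * h (z \<omega>)"
      by (simp add: nn_integral_multc)
    also have "\<dots> = (\<integral>\<^sup>+ b. emeasure (R (z \<omega>)) A * indicator E (b, z \<omega>) \<partial>P (z \<omega>))"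
      by (simp add: nn_integral_cmult mE[OF c] h_def)
    finally show "(\<integral>\<^sup>+ a. (\<lambda>(a, c). indicator A a * h c) (a, z \<omega>) \<partial>R (z \<omega>))
        = (\<integral>\<^sup>+ b. (\<lambda>(b, c). emeasure (R c) A * indicator E (b, c)) (b, z \<omega>) \<partial>P (z \<omega>))"
      by simp
  qed
  also have "\<dots> = (\<integral>\<^sup>+ \<omega>. (\<lambda>(b, c). emeasure (R c) A * indicator E (b, c)) (u \<omega>, z \<omega>) \<partial>M)"
    by (rule nn_integral_conditional_law[OF cu', symmetric]) measurable
  finally show "emeasure M {\<omega> \<in> space M. x \<omega> \<in> A \<and> (u \<omega>, z \<omega>) \<in> E}
      = (\<integral>\<^sup>+ \<omega>. indicator E (u \<omega>, z \<omega>) * emeasure ((\<lambda>\<sigma>. R (snd \<sigma>)) (u \<omega>, z \<omega>)) A \<partial>M)"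
    by (simp add: mult.commute)
qed

section \<open>Rearranging product measures\<close>

text \<open>
  The map \<open>f\<close> is a random variable on \<open>V\<close> with law \<open>L\<close>, where \<open>L\<close> also serves as its value space. This
  makes the relation compose, so the tuples of coordinates below are assembled from the
  elementary maps between product measures.
\<close>

definition has_law :: "'v measure \<Rightarrow> ('v \<Rightarrow> 'l) \<Rightarrow> 'l measure \<Rightarrow> bool" where
  "has_law V f L \<longleftrightarrow> f \<in> V \<rightarrow>\<^sub>M L \<and> distr V L f = L"

lemma has_law_compose:
  assumes "has_law V f L" "has_law L g R"
  shows "has_law V (\<lambda>v. g (f v)) R"
  unfolding has_law_def
proof
  show "(\<lambda>v. g (f v)) \<in> V \<rightarrow>\<^sub>M R"
    using assms by (auto simp: has_law_def)
  show "distr V R (\<lambda>v. g (f v)) = R"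
    using assms distr_distr[of g L R f V] by (simp add: has_law_def comp_def)
qed

lemma has_law_id: "has_law V (\<lambda>v. v) V"
  by (simp add: has_law_def)

lemma has_law_snd:
  assumes "prob_space P" "prob_space Q"
  shows "has_law (P \<Otimes>\<^sub>M Q) snd Q"
proof -
  interpret P: prob_space P by fact
  interpret Q: prob_space Q by fact
  show ?thesis
    unfolding has_law_def
  proof (intro conjI measure_eqI)
    fix B assume "B \<in> sets (distr (P \<Otimes>\<^sub>M Q) Q snd)"
    then have B: "B \<in> sets Q"
      by simp
    then have "snd -` B \<inter> space (P \<Otimes>\<^sub>M Q) = space P \<times> B"
      using sets.sets_into_space[OF B] by (auto simp: space_pair_measure)
    then show "emeasure (distr (P \<Otimes>\<^sub>M Q) Q snd) B = emeasure Q B"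
      using B by (simp add: emeasure_distr Q.emeasure_pair_measure_Times P.emeasure_space_1)
  qed simp_all
qed

lemma has_law_pair_map:
  assumes "prob_space P" "prob_space R" and g: "has_law Q g R"
  shows "has_law (P \<Otimes>\<^sub>M Q) (\<lambda>(a, b). (a, g b)) (P \<Otimes>\<^sub>M R)"
proof -
  have gm[measurable]: "g \<in> Q \<rightarrow>\<^sub>M R" and gd: "distr Q R g = R"
    using g by (auto simp: has_law_def)
  have "sigma_finite_measure (distr Q R g)"
    unfolding gd using \<open>prob_space R\<close>
    by (simp add: prob_space_imp_sigma_finite)
  from pair_measure_distr[OF measurable_ident_sets[OF refl, of P] gm this]
  show ?thesis
    by (simp add: has_law_def gd distr_id)
qed

lemma has_law_assoc:
  assumes "prob_space P" "prob_space Q" "prob_space R"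
  shows "has_law (P \<Otimes>\<^sub>M (Q \<Otimes>\<^sub>M R)) (\<lambda>(a, b, c). ((a, b), c)) ((P \<Otimes>\<^sub>M Q) \<Otimes>\<^sub>M R)"
proof -
  interpret P: prob_space P by fact
  interpret Q: prob_space Q by fact
  interpret R: prob_space R by fact
  interpret QR: pair_prob_space Q R ..
  let ?f = "\<lambda>(a, b, c). ((a, b), c)"
  have f[measurable]: "?f \<in> P \<Otimes>\<^sub>M (Q \<Otimes>\<^sub>M R) \<rightarrow>\<^sub>M (P \<Otimes>\<^sub>M Q) \<Otimes>\<^sub>M R"
    by measurable
  show ?thesis
    unfolding has_law_def
  proof (intro conjI measure_eqI f)
    fix E assume "E \<in> sets (distr (P \<Otimes>\<^sub>M (Q \<Otimes>\<^sub>M R)) ((P \<Otimes>\<^sub>M Q) \<Otimes>\<^sub>M R) ?f)"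
    then have E[measurable]: "E \<in> sets ((P \<Otimes>\<^sub>M Q) \<Otimes>\<^sub>M R)"
      by simp
    have "emeasure (distr (P \<Otimes>\<^sub>M (Q \<Otimes>\<^sub>M R)) ((P \<Otimes>\<^sub>M Q) \<Otimes>\<^sub>M R) ?f) E
        = (\<integral>\<^sup>+ p. indicator E (?f p) \<partial>(P \<Otimes>\<^sub>M (Q \<Otimes>\<^sub>M R)))"
      by (subst nn_integral_indicator[symmetric]) (simp, subst nn_integral_distr, auto)
    also have "\<dots> = (\<integral>\<^sup>+ a. \<integral>\<^sup>+ q. indicator E (?f (a, q)) \<partial>(Q \<Otimes>\<^sub>M R) \<partial>P)"
      by (rule QR.nn_integral_fst[symmetric]) measurable
    also have "\<dots> = (\<integral>\<^sup>+ a. \<integral>\<^sup>+ b. \<integral>\<^sup>+ c. indicator E ((a, b), c) \<partial>R \<partial>Q \<partial>P)"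
      by (intro nn_integral_cong, subst R.nn_integral_fst[symmetric]) auto
    also have "\<dots> = (\<integral>\<^sup>+ p. \<integral>\<^sup>+ c. indicator E (p, c) \<partial>R \<partial>(P \<Otimes>\<^sub>M Q))"
      using Q.nn_integral_fst[of "\<lambda>p. \<integral>\<^sup>+ c. indicator E (p, c) \<partial>R" P] by simp
    also have "\<dots> = emeasure ((P \<Otimes>\<^sub>M Q) \<Otimes>\<^sub>M R) E"
      by (rule R.emeasure_pair_measure[OF E, symmetric])
    finally show "emeasure (distr (P \<Otimes>\<^sub>M (Q \<Otimes>\<^sub>M R)) ((P \<Otimes>\<^sub>M Q) \<Otimes>\<^sub>M R) ?f) E = \<dots>" .
  qed simp
qed

text \<open>
  The only rearrangement here that changes the order of two independent factors; it is
  Fubini's theorem with a third factor carried along.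
\<close>

lemma has_law_left_swap:
  assumes "prob_space P" "prob_space Q" "prob_space R"
  shows "has_law (P \<Otimes>\<^sub>M (Q \<Otimes>\<^sub>M R)) (\<lambda>(a, b, c). (b, a, c)) (Q \<Otimes>\<^sub>M (P \<Otimes>\<^sub>M R))"
proof -
  interpret P: prob_space P by fact
  interpret Q: prob_space Q by fact
  interpret R: prob_space R by fact
  interpret QR: pair_prob_space Q R ..
  interpret PR: pair_prob_space P R ..
  interpret PQ: pair_prob_space P Q ..
  let ?f = "\<lambda>(a, b, c). (b, a, c)"
  have f[measurable]: "?f \<in> P \<Otimes>\<^sub>M (Q \<Otimes>\<^sub>M R) \<rightarrow>\<^sub>M Q \<Otimes>\<^sub>M (P \<Otimes>\<^sub>M R)"
    by measurable
  show ?thesis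
    unfolding has_law_def
  proof (intro conjI measure_eqI f)
    fix E assume "E \<in> sets (distr (P \<Otimes>\<^sub>M (Q \<Otimes>\<^sub>M R)) (Q \<Otimes>\<^sub>M (P \<Otimes>\<^sub>M R)) ?f)"
    then have E[measurable]: "E \<in> sets (Q \<Otimes>\<^sub>M (P \<Otimes>\<^sub>M R))"
      by simp
    have "emeasure (distr (P \<Otimes>\<^sub>M (Q \<Otimes>\<^sub>M R)) (Q \<Otimes>\<^sub>M (P \<Otimes>\<^sub>M R)) ?f) E
        = (\<integral>\<^sup>+ p. indicator E (?f p) \<partial>(P \<Otimes>\<^sub>M (Q \<Otimes>\<^sub>M R)))"
      by (subst nn_integral_indicator[symmetric]) (simp, subst nn_integral_distr, auto)
    also have "\<dots> = (\<integral>\<^sup>+ a. \<integral>\<^sup>+ q. indicator E (?f (a, q)) \<partial>(Q \<Otimes>\<^sub>M R) \<partial>P)"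
      by (rule QR.nn_integral_fst[symmetric]) measurable
    also have "\<dots> = (\<integral>\<^sup>+ a. \<integral>\<^sup>+ b. \<integral>\<^sup>+ c. indicator E (b, a, c) \<partial>R \<partial>Q \<partial>P)"
      by (intro nn_integral_cong, subst R.nn_integral_fst[symmetric]) auto
    also have "\<dots> = (\<integral>\<^sup>+ b. \<integral>\<^sup>+ a. \<integral>\<^sup>+ c. indicator E (b, a, c) \<partial>R \<partial>P \<partial>Q)"
      by (rule PQ.Fubini'[symmetric]) measurable
    also have "\<dots> = (\<integral>\<^sup>+ b. \<integral>\<^sup>+ q. indicator E (b, q) \<partial>(P \<Otimes>\<^sub>M R) \<partial>Q)"
      by (intro nn_integral_cong, subst R.nn_integral_fst[symmetric]) auto
    also have "\<dots> = emeasure (Q \<Otimes>\<^sub>M (P \<Otimes>\<^sub>M R)) E"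
      by (rule PR.emeasure_pair_measure[OF E, symmetric])
    finally show "emeasure (distr (P \<Otimes>\<^sub>M (Q \<Otimes>\<^sub>M R)) (Q \<Otimes>\<^sub>M (P \<Otimes>\<^sub>M R)) ?f) E = \<dots>" .
  qed simp
qed

lemma has_law_return_left:
  assumes "prob_space Q" and k: "k \<in> space N"
  shows "has_law Q (\<lambda>c. (k, c)) (return N k \<Otimes>\<^sub>M Q)"
proof -
  interpret Q: prob_space Q by fact
  interpret R: prob_space "return N k"
    using k by (rule prob_space_return)
  have m[measurable]: "(\<lambda>c. (k, c)) \<in> Q \<rightarrow>\<^sub>M return N k \<Otimes>\<^sub>M Q"
    using k by (intro measurable_Pair1') simp
  have "return N k \<Otimes>\<^sub>M Q = distr Q (return N k \<Otimes>\<^sub>M Q) (\<lambda>c. (k, c))"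
  proof (rule pair_measure_eqI)
    fix A B assume A: "A \<in> sets (return N k)" and B: "B \<in> sets Q"
    have "(\<lambda>c. (k, c)) -` (A \<times> B) \<inter> space Q = (if k \<in> A then B else {})"
      using sets.sets_into_space[OF B] by auto
    then show "emeasure (return N k) A * emeasure Q B
        = emeasure (distr Q (return N k \<Otimes>\<^sub>M Q) (\<lambda>c. (k, c))) (A \<times> B)"
      using A B by (simp add: emeasure_distr)
  qed (simp_all add: Q.sigma_finite_measure_axioms R.sigma_finite_measure_axioms)
  then show ?thesis
    using m by (simp add: has_law_def)
qed

lemma has_law_return_right:
  assumes "prob_space Q" and k: "k \<in> space N"
  shows "has_law Q (\<lambda>c. (c, k)) (Q \<Otimes>\<^sub>M return N k)"
proof -
  interpret Q: prob_space Q by fact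
  interpret R: prob_space "return N k"
    using k by (rule prob_space_return)
  have m[measurable]: "(\<lambda>c. (c, k)) \<in> Q \<rightarrow>\<^sub>M Q \<Otimes>\<^sub>M return N k"
    using k by (intro measurable_Pair2') simp
  have "Q \<Otimes>\<^sub>M return N k = distr Q (Q \<Otimes>\<^sub>M return N k) (\<lambda>c. (c, k))"
  proof (rule pair_measure_eqI)
    fix A B assume A: "A \<in> sets Q" and B: "B \<in> sets (return N k)"
    have "(\<lambda>c. (c, k)) -` (A \<times> B) \<inter> space Q = (if k \<in> B then A else {})"
      using sets.sets_into_space[OF A] by auto
    then show "emeasure Q A * emeasure (return N k) B
        = emeasure (distr Q (Q \<Otimes>\<^sub>M return N k) (\<lambda>c. (c, k))) (A \<times> B)"
      using A B by (simp add: emeasure_distr)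
  qed (simp_all add: Q.sigma_finite_measure_axioms R.sigma_finite_measure_axioms)
  then show ?thesis
    using m by (simp add: has_law_def)
qed

section \<open>Kernels as families of random variables\<close>

lemma markov_kernel_tensor:
  assumes "markov_kernel S M A" "markov_kernel S N B"
  shows "markov_kernel S (M \<Otimes>\<^sub>M N) (A \<Otimes>\<^sub>K B)"
  using measurable_pair_prob[OF assms] by (simp add: tensor_def[abs_def])

lemma markov_kernel_joint:
  assumes "markov_kernel T W K" "markov_kernel (W \<Otimes>\<^sub>M T) M V"
  shows "markov_kernel T M (joint_kernel K V)"
proof -
  have "(\<lambda>(t, w). V (w, t)) \<in> T \<Otimes>\<^sub>M W \<rightarrow>\<^sub>M prob_algebra M"
    using measurable_compose[OF measurable_pair_swap' assms(2)] by (simp add: case_prod_beta')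
  from measurable_bind_prob_space2[OF assms(1) this] show ?thesis
    by (simp add: joint_kernel_def[abs_def])
qed

lemma joint_kernel_distr:
  assumes K: "markov_kernel T W K" and V: "markov_kernel (W \<Otimes>\<^sub>M T) M V"
    and V': "markov_kernel (W \<Otimes>\<^sub>M T) N V'" and t: "t \<in> space T" and f: "f \<in> M \<rightarrow>\<^sub>M N"
    and law: "\<And>w. w \<in> space W \<Longrightarrow> has_law (V (w, t)) f (V' (w, t))"
  shows "joint_kernel K V' t = distr (joint_kernel K V t) N f"
proof -
  have sK: "sets (K t) = sets W" "space (K t) = space W" "prob_space (K t)"
    using markov_kernelD[OF K t] by auto
  have "(\<lambda>w. V (w, t)) \<in> W \<rightarrow>\<^sub>M prob_algebra M"
    using measurable_compose[OF measurable_Pair2'[OF t] V] by (simp add: comp_def)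
  then have Vt: "(\<lambda>w. V (w, t)) \<in> K t \<rightarrow>\<^sub>M subprob_algebra M"
    using sK(1) measurable_cong_sets measurable_prob_algebraD by blast
  have "distr (joint_kernel K V t) N f = K t \<bind> (\<lambda>w. distr (V (w, t)) N f)"
    unfolding joint_kernel_def
    using prob_space.not_empty[OF sK(3)] by (rule distr_bind[OF Vt _ f])
  also have "\<dots> = K t \<bind> (\<lambda>w. V' (w, t))"
  proof (rule bind_cong[OF refl])
    fix w assume "w \<in> space (K t)"
    then have w: "w \<in> space W" "(w, t) \<in> space (W \<Otimes>\<^sub>M T)"
      using t by (simp_all add: sK space_pair_measure)
    have "distr (V (w, t)) N f = distr (V (w, t)) (V' (w, t)) f"
      using markov_kernelD(1)[OF V' w(2)] by (intro distr_cong) auto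
    then show "distr (V (w, t)) N f = V' (w, t)"
      using law[OF w(1)] by (simp add: has_law_def)
  qed
  finally show ?thesis
    by (simp add: joint_kernel_def)
qed

text \<open>
  The second marginal of the law of \<open>(x, s)\<close> is the law of \<open>s\<close>, so at one input \<open>t\<close> the equation
  between a joint kernel and the product with its marginal is the one that defines a
  conditional law. All three notions in the theorem (independence, determination and
  disintegration) are translated by this lemma.
\<close>

lemma kernel_prod_snd_marginal_iff:
  assumes x: "x \<in> M \<rightarrow>\<^sub>M \<X>" and s: "s \<in> M \<rightarrow>\<^sub>M S" and L: "markov_kernel S \<X> (\<lambda>\<sigma>. L (\<sigma>, t))"
    and J: "J t = distr M (\<X> \<Otimes>\<^sub>M S) (\<lambda>\<omega>. (x \<omega>, s \<omega>))"
  shows "J t = kernel_prod S L (snd_marginal S J) t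
         \<longleftrightarrow> conditional_law M \<X> x S s (\<lambda>\<sigma>. L (\<sigma>, t))"
proof -
  note [measurable] = x s
  have "snd_marginal S J t = distr M S s"
    unfolding snd_marginal_def J by (subst distr_distr) (auto simp: comp_def)
  then show ?thesis
    using x s L by (simp add: kernel_prod_def conditional_law_def J)
qed

lemma conditional_law_distr:
  assumes f: "f \<in> M \<rightarrow>\<^sub>M N" and c: "conditional_law (distr M N f) \<X> x S s L"
  shows "conditional_law M \<X> (\<lambda>\<omega>. x (f \<omega>)) S (\<lambda>\<omega>. s (f \<omega>)) L"
proof -
  have [measurable]: "x \<in> N \<rightarrow>\<^sub>M \<X>" "s \<in> N \<rightarrow>\<^sub>M S"
    using conditional_lawD(1,2)[OF c] by simp_all
  show ?thesis
    using c f unfolding conditional_law_def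
    by (simp add: distr_distr comp_def)
qed

lemma disintegration_tripleD:
  assumes "disintegration_triple \<X> \<Y> \<Z>" and J: "markov_kernel \<Z> (\<X> \<Otimes>\<^sub>M \<Y>) J"
  obtains L where "markov_kernel (\<Y> \<Otimes>\<^sub>M \<Z>) \<X> L"
    and "\<And>c. c \<in> space \<Z> \<Longrightarrow> conditional_law (J c) \<X> fst \<Y> snd (\<lambda>b. L (b, c))"
proof -
  obtain L where L: "markov_kernel (\<Y> \<Otimes>\<^sub>M \<Z>) \<X> L"
    and eq: "\<And>c. c \<in> space \<Z> \<Longrightarrow> J c = kernel_prod \<Y> L (snd_marginal \<Y> J) c"
    using assms unfolding disintegration_triple_def by blast
  have "conditional_law (J c) \<X> fst \<Y> snd (\<lambda>b. L (b, c))" if c: "c \<in> space \<Z>" for c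
  proof -
    have sJ: "sets (J c) = sets (\<X> \<Otimes>\<^sub>M \<Y>)"
      using markov_kernelD(1)[OF J c] .
    have "markov_kernel \<Y> \<X> (\<lambda>b. L (b, c))"
      using measurable_compose[OF measurable_Pair2'[OF c] L] by (simp add: comp_def)
    moreover have "J c = distr (J c) (\<X> \<Otimes>\<^sub>M \<Y>) (\<lambda>\<omega>. (fst \<omega>, snd \<omega>))"
      using sJ by (simp add: distr_id2)
    moreover have "fst \<in> J c \<rightarrow>\<^sub>M \<X>" "snd \<in> J c \<rightarrow>\<^sub>M \<Y>"
      using sJ by (simp_all cong: measurable_cong_sets)
    ultimately show ?thesis
      using kernel_prod_snd_marginal_iff[of fst "J c" \<X> snd \<Y> L c J] eq[OF c] by blast
  qed
  with L show thesis
    using that by blast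
qed

text \<open>
  If \<open>A\<close>, \<open>B\<close>, \<open>C\<close> are represented, for every \<open>(w, t)\<close>, by independent random variables on a common
  space with law \<open>V (w, t)\<close>, then their joint kernel is an image of that of \<open>V\<close>. This lets several independence
  statements be compared on one probability space. The representation \<open>s\<close> of \<open>B\<close> and
  \<open>C\<close> may depend on \<open>t\<close>, which covers the input variable as a constant.
\<close>

lemma trans_ci_iff_conditional_law:
  assumes K: "markov_kernel T W K" and V: "markov_kernel (W \<Otimes>\<^sub>M T) \<V> V"
    and A: "markov_kernel (W \<Otimes>\<^sub>M T) \<A> A" and B: "markov_kernel (W \<Otimes>\<^sub>M T) \<B> B"
    and C: "markov_kernel (W \<Otimes>\<^sub>M T) \<C> C"
    and a: "a \<in> \<V> \<rightarrow>\<^sub>M \<A>" and s: "\<And>t. t \<in> space T \<Longrightarrow> s t \<in> \<V> \<rightarrow>\<^sub>M \<B> \<Otimes>\<^sub>M \<C>"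
    and law: "\<And>w t. w \<in> space W \<Longrightarrow> t \<in> space T \<Longrightarrow>
      has_law (V (w, t)) (\<lambda>v. (a v, s t v)) (A (w, t) \<Otimes>\<^sub>M B (w, t) \<Otimes>\<^sub>M C (w, t))"
  shows "trans_ci T K \<A> A \<B> B \<C> C \<longleftrightarrow>
    (\<exists>Q. markov_kernel \<C> \<A> Q \<and> (\<forall>t\<in>space T.
       conditional_law (joint_kernel K V t) \<A> a (\<B> \<Otimes>\<^sub>M \<C>) (s t) (\<lambda>\<sigma>. Q (snd \<sigma>))))"
proof -
  let ?J = "joint_kernel K (A \<Otimes>\<^sub>K B \<Otimes>\<^sub>K C)"
  have "?J t = kernel_prod (\<B> \<Otimes>\<^sub>M \<C>) (\<lambda>((b, c), t). Q c) (snd_marginal (\<B> \<Otimes>\<^sub>M \<C>) ?J) t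
      \<longleftrightarrow> conditional_law (joint_kernel K V t) \<A> a (\<B> \<Otimes>\<^sub>M \<C>) (s t) (\<lambda>\<sigma>. Q (snd \<sigma>))"
    if Q: "markov_kernel \<C> \<A> Q" and t: "t \<in> space T" for Q t
  proof -
    have sets: "sets (joint_kernel K V t) = sets \<V>"
      using markov_kernelD(1)[OF markov_kernel_joint[OF K V] t] .
    note st = s[OF t]
    have "?J t = distr (joint_kernel K V t) (\<A> \<Otimes>\<^sub>M \<B> \<Otimes>\<^sub>M \<C>) (\<lambda>v. (a v, s t v))"
    proof (rule joint_kernel_distr[OF K V _ t])
      show "markov_kernel (W \<Otimes>\<^sub>M T) (\<A> \<Otimes>\<^sub>M \<B> \<Otimes>\<^sub>M \<C>) (A \<Otimes>\<^sub>K B \<Otimes>\<^sub>K C)"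
        by (intro markov_kernel_tensor A B C)
      show "(\<lambda>v. (a v, s t v)) \<in> \<V> \<rightarrow>\<^sub>M \<A> \<Otimes>\<^sub>M \<B> \<Otimes>\<^sub>M \<C>"
        using a st by measurable
    qed (use law t in \<open>simp add: tensor_def\<close>)
    moreover have "a \<in> joint_kernel K V t \<rightarrow>\<^sub>M \<A>" "s t \<in> joint_kernel K V t \<rightarrow>\<^sub>M \<B> \<Otimes>\<^sub>M \<C>"
      using a st sets by (simp_all cong: measurable_cong_sets)
    moreover have "markov_kernel (\<B> \<Otimes>\<^sub>M \<C>) \<A> (\<lambda>\<sigma>. (\<lambda>((b, c), t). Q c) (\<sigma>, t))"
      using measurable_compose[OF measurable_snd Q] by (simp add: case_prod_beta')
    ultimately show ?thesis
      by (subst kernel_prod_snd_marginal_iff) (simp_all add: case_prod_beta')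
  qed
  then show ?thesis
    unfolding trans_ci_def by blast
qed


text \<open>
  The groupings of the four independent coordinates to which the separoid rules reduce. A
  name ending such as \<open>xu_yz\<close> reads: \<open>x\<close> and \<open>u\<close> form one variable, followed by \<open>y\<close> and \<open>z\<close>.
\<close>

lemma coordinate_laws:
  fixes A :: "'x measure" and B :: "'y measure" and D :: "'u measure" and C :: "'z measure"
  assumes A: "prob_space A" and B: "prob_space B" and D: "prob_space D" and C: "prob_space C"
  defines "V \<equiv> A \<Otimes>\<^sub>M B \<Otimes>\<^sub>M D \<Otimes>\<^sub>M C"
  shows coordinate_law_xz: "has_law V (\<lambda>(a, b, d, c). (a, c)) (A \<Otimes>\<^sub>M C)"
    and coordinate_law_xyz: "has_law V (\<lambda>(a, b, d, c). (a, b, c)) (A \<Otimes>\<^sub>M B \<Otimes>\<^sub>M C)"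
    and coordinate_law_xuz: "has_law V (\<lambda>(a, b, d, c). (a, d, c)) (A \<Otimes>\<^sub>M D \<Otimes>\<^sub>M C)"
    and coordinate_law_uxz: "has_law V (\<lambda>(a, b, d, c). (d, a, c)) (D \<Otimes>\<^sub>M A \<Otimes>\<^sub>M C)"
    and coordinate_law_uyz: "has_law V (\<lambda>(a, b, d, c). (d, b, c)) (D \<Otimes>\<^sub>M B \<Otimes>\<^sub>M C)"
    and coordinate_law_yuz: "has_law V (\<lambda>(a, b, d, c). (b, d, c)) (B \<Otimes>\<^sub>M D \<Otimes>\<^sub>M C)"
    and coordinate_law_xyuz: "has_law V (\<lambda>(a, b, d, c). (a, b, d, c)) (A \<Otimes>\<^sub>M B \<Otimes>\<^sub>M D \<Otimes>\<^sub>M C)"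
    and coordinate_law_xyu_z: "has_law V (\<lambda>(a, b, d, c). (a, (b, d), c)) (A \<Otimes>\<^sub>M (B \<Otimes>\<^sub>M D) \<Otimes>\<^sub>M C)"
    and coordinate_law_xu_yz: "has_law V (\<lambda>(a, b, d, c). ((a, d), b, c)) ((A \<Otimes>\<^sub>M D) \<Otimes>\<^sub>M B \<Otimes>\<^sub>M C)"
    and coordinate_law_yxu_z: "has_law V (\<lambda>(a, b, d, c). (b, (a, d), c)) (B \<Otimes>\<^sub>M (A \<Otimes>\<^sub>M D) \<Otimes>\<^sub>M C)"
proof -
  have DC: "prob_space (D \<Otimes>\<^sub>M C)" and BC: "prob_space (B \<Otimes>\<^sub>M C)" and AC: "prob_space (A \<Otimes>\<^sub>M C)"
    and BD: "prob_space (B \<Otimes>\<^sub>M D)" and AD: "prob_space (A \<Otimes>\<^sub>M D)"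
    using A B C D by (simp_all add: prob_space_pair)
  have bdc: "has_law V (\<lambda>v. snd v) (B \<Otimes>\<^sub>M D \<Otimes>\<^sub>M C)"
    unfolding V_def using has_law_snd A B DC prob_space_pair by blast
  have bc: "has_law (B \<Otimes>\<^sub>M D \<Otimes>\<^sub>M C) (\<lambda>(b, q). (b, snd q)) (B \<Otimes>\<^sub>M C)"
    by (rule has_law_pair_map[OF B C has_law_snd[OF D C]])
  have dbc: "has_law (B \<Otimes>\<^sub>M D \<Otimes>\<^sub>M C) (\<lambda>(b, d, c). (d, b, c)) (D \<Otimes>\<^sub>M B \<Otimes>\<^sub>M C)"
    by (rule has_law_left_swap[OF B D C])
  show *: "has_law V (\<lambda>(a, b, d, c). (a, b, d, c)) (A \<Otimes>\<^sub>M B \<Otimes>\<^sub>M D \<Otimes>\<^sub>M C)"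
    using has_law_id[of V] by (simp add: V_def case_prod_beta')
  show xyz: "has_law V (\<lambda>(a, b, d, c). (a, b, c)) (A \<Otimes>\<^sub>M B \<Otimes>\<^sub>M C)"
    using has_law_pair_map[OF A BC bc] by (simp add: V_def case_prod_beta')
  show "has_law V (\<lambda>(a, b, d, c). (a, c)) (A \<Otimes>\<^sub>M C)"
    using has_law_compose[OF xyz has_law_pair_map[OF A C has_law_snd[OF B C]]]
    by (simp add: case_prod_beta')
  show xuz: "has_law V (\<lambda>(a, b, d, c). (a, d, c)) (A \<Otimes>\<^sub>M D \<Otimes>\<^sub>M C)"
    using has_law_pair_map[OF A DC has_law_snd[OF B DC]] by (simp add: V_def case_prod_beta')
  show "has_law V (\<lambda>(a, b, d, c). (d, a, c)) (D \<Otimes>\<^sub>M A \<Otimes>\<^sub>M C)"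
    using has_law_compose[OF xuz has_law_left_swap[OF A D C]] by (simp add: case_prod_beta')
  show "has_law V (\<lambda>(a, b, d, c). (d, b, c)) (D \<Otimes>\<^sub>M B \<Otimes>\<^sub>M C)"
    using has_law_compose[OF bdc dbc] by (simp add: case_prod_beta')
  show "has_law V (\<lambda>(a, b, d, c). (b, d, c)) (B \<Otimes>\<^sub>M D \<Otimes>\<^sub>M C)"
    using bdc by (simp add: case_prod_beta')
  show "has_law V (\<lambda>(a, b, d, c). (a, (b, d), c)) (A \<Otimes>\<^sub>M (B \<Otimes>\<^sub>M D) \<Otimes>\<^sub>M C)"
    using has_law_pair_map[OF A prob_space_pair[OF BD C] has_law_assoc[OF B D C]]
    by (simp add: V_def case_prod_beta')
  show "has_law V (\<lambda>(a, b, d, c). ((a, d), b, c)) ((A \<Otimes>\<^sub>M D) \<Otimes>\<^sub>M B \<Otimes>\<^sub>M C)"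
    using has_law_compose[OF has_law_pair_map[OF A prob_space_pair[OF D BC] dbc]
        has_law_assoc[OF A D BC]]
    by (simp add: V_def case_prod_beta')
  show "has_law V (\<lambda>(a, b, d, c). (b, (a, d), c)) (B \<Otimes>\<^sub>M (A \<Otimes>\<^sub>M D) \<Otimes>\<^sub>M C)"
    using has_law_compose[OF has_law_left_swap[OF A B DC]
        has_law_pair_map[OF B prob_space_pair[OF AD C] has_law_assoc[OF A D C]]]
    by (simp add: V_def case_prod_beta')
qed

section \<open>The separoid rules\<close>

theorem theorem3p14:
  fixes W :: "'w measure" and T :: "'t measure" and K :: "'t \<Rightarrow> 'w measure"
    and \<X> :: "'x measure" and X :: "'w \<times> 't \<Rightarrow> 'x measure"
    and \<Y> :: "'y measure" and Y :: "'w \<times> 't \<Rightarrow> 'y measure"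
    and \<Z> :: "'z measure" and Z :: "'w \<times> 't \<Rightarrow> 'z measure"
    and \<U> :: "'u measure" and U :: "'w \<times> 't \<Rightarrow> 'u measure"
  assumes "transition_probability_space W T K"
    and "transitional_random_variable W T \<X> X"
    and "transitional_random_variable W T \<Y> Y"
    and "transitional_random_variable W T \<Z> Z"
    and "transitional_random_variable W T \<U> U"
  shows
    "(determined_by T K \<X> X \<Z> Z \<longrightarrow> trans_ci T K \<X> X \<Y> Y \<Z> Z) \<and>
     (disintegration_triple \<X> \<Z> T \<longrightarrow>
        trans_ci T K \<X> X point_space delta_star (\<Z> \<Otimes>\<^sub>M T) (Z \<Otimes>\<^sub>K input_var T)) \<and>
     (trans_ci T K (\<X> \<Otimes>\<^sub>M \<U>) (X \<Otimes>\<^sub>K U) \<Y> Y \<Z> Z \<longrightarrow> trans_ci T K \<U> U \<Y> Y \<Z> Z) \<and>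
     (trans_ci T K \<X> X (\<Y> \<Otimes>\<^sub>M \<U>) (Y \<Otimes>\<^sub>K U) \<Z> Z \<longrightarrow> trans_ci T K \<X> X \<U> U \<Z> Z) \<and>
     (trans_ci T K \<X> X \<Y> Y \<Z> Z \<longrightarrow>
        trans_ci T K \<X> X (T \<Otimes>\<^sub>M \<Y>) (input_var T \<Otimes>\<^sub>K Y) \<Z> Z) \<and>
     (disintegration_triple \<X> \<U> \<Z> \<longrightarrow>
        trans_ci T K (\<X> \<Otimes>\<^sub>M \<U>) (X \<Otimes>\<^sub>K U) \<Y> Y \<Z> Z \<longrightarrow>
        trans_ci T K \<X> X \<Y> Y (\<U> \<Otimes>\<^sub>M \<Z>) (U \<Otimes>\<^sub>K Z)) \<and>
     (trans_ci T K \<X> X (\<Y> \<Otimes>\<^sub>M \<U>) (Y \<Otimes>\<^sub>K U) \<Z> Z \<longrightarrow>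
        trans_ci T K \<X> X \<Y> Y (\<U> \<Otimes>\<^sub>M \<Z>) (U \<Otimes>\<^sub>K Z)) \<and>
     (trans_ci T K \<X> X \<Y> Y (\<U> \<Otimes>\<^sub>M \<Z>) (U \<Otimes>\<^sub>K Z) \<and> trans_ci T K \<U> U \<Y> Y \<Z> Z \<longrightarrow>
        trans_ci T K (\<X> \<Otimes>\<^sub>M \<U>) (X \<Otimes>\<^sub>K U) \<Y> Y \<Z> Z) \<and>
     (trans_ci T K \<X> X \<Y> Y (\<U> \<Otimes>\<^sub>M \<Z>) (U \<Otimes>\<^sub>K Z) \<and> trans_ci T K \<X> X \<U> U \<Z> Z \<longrightarrow>
        trans_ci T K \<X> X (\<Y> \<Otimes>\<^sub>M \<U>) (Y \<Otimes>\<^sub>K U) \<Z> Z) \<and>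
     (trans_ci T K \<X> X \<Y> Y (\<U> \<Otimes>\<^sub>M \<Z>) (U \<Otimes>\<^sub>K Z) \<and> trans_ci T K \<U> U \<X> X \<Z> Z \<longrightarrow>
        trans_ci T K \<X> X (\<Y> \<Otimes>\<^sub>M \<U>) (Y \<Otimes>\<^sub>K U) \<Z> Z) \<and>
     (trans_ci T K \<X> X \<Y> Y (\<U> \<Otimes>\<^sub>M \<Z>) (U \<Otimes>\<^sub>K Z) \<and> trans_ci T K \<Y> Y \<U> U \<Z> Z \<longrightarrow>
        trans_ci T K \<Y> Y (\<X> \<Otimes>\<^sub>M \<U>) (X \<Otimes>\<^sub>K U) \<Z> Z)"
proof -
  have K: "markov_kernel T W K"
    using assms by (simp add: transition_probability_space_def)
  have X: "markov_kernel (W \<Otimes>\<^sub>M T) \<X> X" and Y: "markov_kernel (W \<Otimes>\<^sub>M T) \<Y> Y"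
    and Z: "markov_kernel (W \<Otimes>\<^sub>M T) \<Z> Z" and U: "markov_kernel (W \<Otimes>\<^sub>M T) \<U> U"
    using assms by (simp_all add: transitional_random_variable_def)
  let ?\<V> = "\<X> \<Otimes>\<^sub>M \<Y> \<Otimes>\<^sub>M \<U> \<Otimes>\<^sub>M \<Z>" and ?V = "X \<Otimes>\<^sub>K Y \<Otimes>\<^sub>K U \<Otimes>\<^sub>K Z"
  have V: "markov_kernel (W \<Otimes>\<^sub>M T) ?\<V> ?V"
    by (intro markov_kernel_tensor X Y Z U)
  define P where "P = joint_kernel K ?V"
  have PK: "markov_kernel T ?\<V> P"
    unfolding P_def by (rule markov_kernel_joint[OF K V])
  have P: "prob_space (P t)" if "t \<in> space T" for t
    using markov_kernelD(3)[OF PK that] .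
  define x :: "'x \<times> 'y \<times> 'u \<times> 'z \<Rightarrow> 'x" where "x = fst"
  define y :: "'x \<times> 'y \<times> 'u \<times> 'z \<Rightarrow> 'y" where "y v = fst (snd v)" for v
  define u :: "'x \<times> 'y \<times> 'u \<times> 'z \<Rightarrow> 'u" where "u v = fst (snd (snd v))" for v
  define z :: "'x \<times> 'y \<times> 'u \<times> 'z \<Rightarrow> 'z" where "z v = snd (snd (snd v))" for v
  note coord = x_def y_def u_def z_def
  have xm[measurable]: "x \<in> ?\<V> \<rightarrow>\<^sub>M \<X>" and ym[measurable]: "y \<in> ?\<V> \<rightarrow>\<^sub>M \<Y>"
    and um[measurable]: "u \<in> ?\<V> \<rightarrow>\<^sub>M \<U>" and zm[measurable]: "z \<in> ?\<V> \<rightarrow>\<^sub>M \<Z>"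
    unfolding coord[abs_def] by measurable
  have prob: "prob_space (X (w, t))" "prob_space (Y (w, t))" "prob_space (U (w, t))"
      "prob_space (Z (w, t))" if "w \<in> space W" "t \<in> space T" for w t
    using that markov_kernelD(3)[OF X] markov_kernelD(3)[OF Y] markov_kernelD(3)[OF U]
      markov_kernelD(3)[OF Z] by (auto simp: space_pair_measure)
  note laws = coordinate_laws[of "X (w, t)" "Y (w, t)" "U (w, t)" "Z (w, t)" for w t, OF prob]
  note ci_iff = trans_ci_iff_conditional_law[OF K V, folded P_def]
  have inputT: "markov_kernel (W \<Otimes>\<^sub>M T) T (input_var T)"
    using measurable_compose[OF measurable_snd measurable_return_prob_space]
    by (simp add: input_var_def case_prod_beta')
  have star: "markov_kernel (W \<Otimes>\<^sub>M T) point_space delta_star"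
    unfolding delta_star_def
    by (rule measurable_const) (simp add: space_prob_algebra prob_space_return)

  \<comment> \<open>Each independence statement, translated to the coordinates under \<open>P t\<close>.\<close>
  have X_Y_Z: "trans_ci T K \<X> X \<Y> Y \<Z> Z \<longleftrightarrow> (\<exists>Q. markov_kernel \<Z> \<X> Q \<and> (\<forall>t\<in>space T.
      conditional_law (P t) \<X> x (\<Y> \<Otimes>\<^sub>M \<Z>) (\<lambda>v. (y v, z v)) (\<lambda>\<sigma>. Q (snd \<sigma>))))"
    by (rule ci_iff[OF X Y Z])
       (use laws(2) in \<open>simp_all add: tensor_def coord case_prod_beta'\<close>)
  have X_U_Z: "trans_ci T K \<X> X \<U> U \<Z> Z \<longleftrightarrow> (\<exists>Q. markov_kernel \<Z> \<X> Q \<and> (\<forall>t\<in>space T.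
      conditional_law (P t) \<X> x (\<U> \<Otimes>\<^sub>M \<Z>) (\<lambda>v. (u v, z v)) (\<lambda>\<sigma>. Q (snd \<sigma>))))"
    by (rule ci_iff[OF X U Z])
       (use laws(3) in \<open>simp_all add: tensor_def coord case_prod_beta'\<close>)
  have U_X_Z: "trans_ci T K \<U> U \<X> X \<Z> Z \<longleftrightarrow> (\<exists>Q. markov_kernel \<Z> \<U> Q \<and> (\<forall>t\<in>space T.
      conditional_law (P t) \<U> u (\<X> \<Otimes>\<^sub>M \<Z>) (\<lambda>v. (x v, z v)) (\<lambda>\<sigma>. Q (snd \<sigma>))))"
    by (rule ci_iff[OF U X Z])
       (use laws(4) in \<open>simp_all add: tensor_def coord case_prod_beta'\<close>)
  have U_Y_Z: "trans_ci T K \<U> U \<Y> Y \<Z> Z \<longleftrightarrow> (\<exists>Q. markov_kernel \<Z> \<U> Q \<and> (\<forall>t\<in>space T.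
      conditional_law (P t) \<U> u (\<Y> \<Otimes>\<^sub>M \<Z>) (\<lambda>v. (y v, z v)) (\<lambda>\<sigma>. Q (snd \<sigma>))))"
    by (rule ci_iff[OF U Y Z])
       (use laws(5) in \<open>simp_all add: tensor_def coord case_prod_beta'\<close>)
  have Y_U_Z: "trans_ci T K \<Y> Y \<U> U \<Z> Z \<longleftrightarrow> (\<exists>Q. markov_kernel \<Z> \<Y> Q \<and> (\<forall>t\<in>space T.
      conditional_law (P t) \<Y> y (\<U> \<Otimes>\<^sub>M \<Z>) (\<lambda>v. (u v, z v)) (\<lambda>\<sigma>. Q (snd \<sigma>))))"
    by (rule ci_iff[OF Y U Z])
       (use laws(6) in \<open>simp_all add: tensor_def coord case_prod_beta'\<close>)
  have X_Y_UZ: "trans_ci T K \<X> X \<Y> Y (\<U> \<Otimes>\<^sub>M \<Z>) (U \<Otimes>\<^sub>K Z) \<longleftrightarrow>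
      (\<exists>Q. markov_kernel (\<U> \<Otimes>\<^sub>M \<Z>) \<X> Q \<and> (\<forall>t\<in>space T.
      conditional_law (P t) \<X> x (\<Y> \<Otimes>\<^sub>M \<U> \<Otimes>\<^sub>M \<Z>) (\<lambda>v. (y v, u v, z v)) (\<lambda>\<sigma>. Q (snd \<sigma>))))"
    by (rule ci_iff[OF X Y markov_kernel_tensor[OF U Z]])
       (use laws(7) in \<open>simp_all add: tensor_def coord case_prod_beta'\<close>)
  have X_YU_Z: "trans_ci T K \<X> X (\<Y> \<Otimes>\<^sub>M \<U>) (Y \<Otimes>\<^sub>K U) \<Z> Z \<longleftrightarrow>
      (\<exists>Q. markov_kernel \<Z> \<X> Q \<and> (\<forall>t\<in>space T.
      conditional_law (P t) \<X> x ((\<Y> \<Otimes>\<^sub>M \<U>) \<Otimes>\<^sub>M \<Z>) (\<lambda>v. ((y v, u v), z v)) (\<lambda>\<sigma>. Q (snd \<sigma>))))"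
    by (rule ci_iff[OF X markov_kernel_tensor[OF Y U] Z])
       (use laws(8) in \<open>simp_all add: tensor_def coord case_prod_beta'\<close>)
  have XU_Y_Z: "trans_ci T K (\<X> \<Otimes>\<^sub>M \<U>) (X \<Otimes>\<^sub>K U) \<Y> Y \<Z> Z \<longleftrightarrow>
      (\<exists>Q. markov_kernel \<Z> (\<X> \<Otimes>\<^sub>M \<U>) Q \<and> (\<forall>t\<in>space T.
      conditional_law (P t) (\<X> \<Otimes>\<^sub>M \<U>) (\<lambda>v. (x v, u v)) (\<Y> \<Otimes>\<^sub>M \<Z>) (\<lambda>v. (y v, z v)) (\<lambda>\<sigma>. Q (snd \<sigma>))))"
    by (rule ci_iff[OF markov_kernel_tensor[OF X U] Y Z])
       (use laws(9) in \<open>simp_all add: tensor_def coord case_prod_beta'\<close>)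
  have Y_XU_Z: "trans_ci T K \<Y> Y (\<X> \<Otimes>\<^sub>M \<U>) (X \<Otimes>\<^sub>K U) \<Z> Z \<longleftrightarrow>
      (\<exists>Q. markov_kernel \<Z> \<Y> Q \<and> (\<forall>t\<in>space T.
      conditional_law (P t) \<Y> y ((\<X> \<Otimes>\<^sub>M \<U>) \<Otimes>\<^sub>M \<Z>) (\<lambda>v. ((x v, u v), z v)) (\<lambda>\<sigma>. Q (snd \<sigma>))))"
    by (rule ci_iff[OF Y markov_kernel_tensor[OF X U] Z])
       (use laws(10) in \<open>simp_all add: tensor_def coord case_prod_beta'\<close>)
  have X_TY_Z: "trans_ci T K \<X> X (T \<Otimes>\<^sub>M \<Y>) (input_var T \<Otimes>\<^sub>K Y) \<Z> Z \<longleftrightarrow>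
      (\<exists>Q. markov_kernel \<Z> \<X> Q \<and> (\<forall>t\<in>space T.
      conditional_law (P t) \<X> x ((T \<Otimes>\<^sub>M \<Y>) \<Otimes>\<^sub>M \<Z>) (\<lambda>v. ((t, y v), z v)) (\<lambda>\<sigma>. Q (snd \<sigma>))))"
  proof (rule ci_iff[OF X markov_kernel_tensor[OF inputT Y] Z])
    fix w t assume w: "w \<in> space W" and t: "t \<in> space T"
    note pr = prob[OF w t] and R = prob_space_return[OF t]
    have "has_law (Y (w, t) \<Otimes>\<^sub>M Z (w, t)) (\<lambda>q. ((t, fst q), snd q)) ((return T t \<Otimes>\<^sub>M Y (w, t)) \<Otimes>\<^sub>M Z (w, t))"
      using has_law_compose[OF has_law_return_left[OF prob_space_pair[OF pr(2,4)] t]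
          has_law_assoc[OF R pr(2,4)]]
      by (simp add: case_prod_beta')
    from has_law_compose[OF laws(2)[OF w t] has_law_pair_map[OF pr(1) _ this]]
    show "has_law (?V (w, t)) (\<lambda>v. (x v, (t, y v), z v))
        (X (w, t) \<Otimes>\<^sub>M (input_var T \<Otimes>\<^sub>K Y) (w, t) \<Otimes>\<^sub>M Z (w, t))"
      using R pr w t by (simp add: tensor_def coord case_prod_beta' input_var_def prob_space_pair)
  qed measurable
  have X_star_ZT: "trans_ci T K \<X> X point_space delta_star (\<Z> \<Otimes>\<^sub>M T) (Z \<Otimes>\<^sub>K input_var T) \<longleftrightarrow>
      (\<exists>Q. markov_kernel (\<Z> \<Otimes>\<^sub>M T) \<X> Q \<and> (\<forall>t\<in>space T.
      conditional_law (P t) \<X> x (point_space \<Otimes>\<^sub>M \<Z> \<Otimes>\<^sub>M T) (\<lambda>v. ((), z v, t)) (\<lambda>\<sigma>. Q (snd \<sigma>))))"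
  proof (rule ci_iff[OF X star markov_kernel_tensor[OF Z inputT]])
    fix w t assume w: "w \<in> space W" and t: "t \<in> space T"
    note pr = prob[OF w t] and R = prob_space_return[OF t]
    have S: "prob_space (return point_space ())"
      by (rule prob_space_return) simp
    have ZT: "prob_space (Z (w, t) \<Otimes>\<^sub>M return T t)"
      using pr(4) R by (rule prob_space_pair)
    have "has_law (Z (w, t)) (\<lambda>c. ((), c, t)) (return point_space () \<Otimes>\<^sub>M Z (w, t) \<Otimes>\<^sub>M return T t)"
      by (rule has_law_compose[OF has_law_return_right[OF pr(4) t] has_law_return_left[OF ZT]]) simp
    from has_law_compose[OF laws(1)[OF w t] has_law_pair_map[OF pr(1) prob_space_pair[OF S ZT] this]]
    show "has_law (?V (w, t)) (\<lambda>v. (x v, (), z v, t))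
        (X (w, t) \<Otimes>\<^sub>M delta_star (w, t) \<Otimes>\<^sub>M (Z \<Otimes>\<^sub>K input_var T) (w, t))"
      using w t by (simp add: tensor_def coord case_prod_beta' input_var_def delta_star_def)
  qed measurable

  \<comment> \<open>The joint kernel of \<open>X\<close> and \<open>Z\<close>, as used by determination and by the disintegration over \<open>T\<close>.\<close>
  have XZ_kernel: "markov_kernel T (\<X> \<Otimes>\<^sub>M \<Z>) (joint_kernel K (X \<Otimes>\<^sub>K Z))"
    by (intro markov_kernel_joint[OF K] markov_kernel_tensor X Z)
  have XZ: "joint_kernel K (X \<Otimes>\<^sub>K Z) t = distr (P t) (\<X> \<Otimes>\<^sub>M \<Z>) (\<lambda>v. (x v, z v))"
    if t: "t \<in> space T" for t
    unfolding P_def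
    by (rule joint_kernel_distr[OF K V markov_kernel_tensor[OF X Z] t])
       (use laws(1) t in \<open>simp_all add: tensor_def coord case_prod_beta'\<close>)
  have Pm: "f \<in> P t \<rightarrow>\<^sub>M N \<longleftrightarrow> f \<in> ?\<V> \<rightarrow>\<^sub>M N" if "t \<in> space T" for t f and N :: "'n measure"
    using markov_kernelD(1)[OF PK that] by (simp cong: measurable_cong_sets)

  have left_redundancy: "trans_ci T K \<X> X \<Y> Y \<Z> Z" if h: "determined_by T K \<X> X \<Z> Z"
  proof -
    obtain \<phi> where \<phi>: "\<phi> \<in> \<Z> \<rightarrow>\<^sub>M \<X>" and eq: "\<And>t. t \<in> space T \<Longrightarrow>
        joint_kernel K (X \<Otimes>\<^sub>K Z) t = kernel_prod \<Z> (\<lambda>(z, t). return \<X> (\<phi> z))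
          (snd_marginal \<Z> (joint_kernel K (X \<Otimes>\<^sub>K Z))) t"
      using h unfolding determined_by_def by blast
    have \<phi>k: "markov_kernel \<Z> \<X> (\<lambda>c. return \<X> (\<phi> c))"
      using measurable_compose[OF \<phi> measurable_return_prob_space] .
    have "conditional_law (P t) \<X> x (\<Y> \<Otimes>\<^sub>M \<Z>) (\<lambda>v. (y v, z v)) (\<lambda>\<sigma>. return \<X> (\<phi> (snd \<sigma>)))"
      if t: "t \<in> space T" for t
    proof (rule prob_space.conditional_law_dirac_refine[OF P[OF t] _ \<phi> measurable_snd])
      show "conditional_law (P t) \<X> x \<Z> z (\<lambda>c. return \<X> (\<phi> c))"
        using eq[OF t] kernel_prod_snd_marginal_iff[of x "P t" \<X> z \<Z> "\<lambda>(z, t). return \<X> (\<phi> z)" t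
            "joint_kernel K (X \<Otimes>\<^sub>K Z)", OF _ _ _ XZ[OF t]] \<phi>k
        by (simp add: Pm[OF t])
    qed (simp_all add: Pm[OF t])
    with \<phi>k show ?thesis
      unfolding X_Y_Z by (intro exI[of _ "\<lambda>c. return \<X> (\<phi> c)"]) simp
  qed
  have right_redundancy: "trans_ci T K \<X> X point_space delta_star (\<Z> \<Otimes>\<^sub>M T) (Z \<Otimes>\<^sub>K input_var T)"
    if h: "disintegration_triple \<X> \<Z> T"
  proof -
    obtain L where L: "markov_kernel (\<Z> \<Otimes>\<^sub>M T) \<X> L" and c: "\<And>t. t \<in> space T \<Longrightarrow>
        conditional_law (joint_kernel K (X \<Otimes>\<^sub>K Z) t) \<X> fst \<Z> snd (\<lambda>b. L (b, t))"
      using disintegration_tripleD[OF h XZ_kernel] by blast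
    have "conditional_law (P t) \<X> x (point_space \<Otimes>\<^sub>M \<Z> \<Otimes>\<^sub>M T) (\<lambda>v. ((), z v, t)) (\<lambda>\<sigma>. L (snd \<sigma>))"
      if t: "t \<in> space T" for t
    proof (rule prob_space.conditional_law_coarsen[OF P[OF t], where g = "\<lambda>c. ((), c, t)"])
      show "conditional_law (P t) \<X> x \<Z> z (\<lambda>c. L (c, t))"
        using conditional_law_distr[OF _ c[OF t, unfolded XZ[OF t]]] by (simp add: Pm[OF t])
      show "(\<lambda>c. ((), c, t)) \<in> \<Z> \<rightarrow>\<^sub>M point_space \<Otimes>\<^sub>M \<Z> \<Otimes>\<^sub>M T"
        using t by measurable
      show "markov_kernel (point_space \<Otimes>\<^sub>M \<Z> \<Otimes>\<^sub>M T) \<X> (\<lambda>\<sigma>. L (snd \<sigma>))"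
        by (rule measurable_compose[OF measurable_snd L])
    qed simp_all
    with L show ?thesis
      unfolding X_star_ZT by blast
  qed
  have left_decomposition: "trans_ci T K \<U> U \<Y> Y \<Z> Z" if h: "trans_ci T K (\<X> \<Otimes>\<^sub>M \<U>) (X \<Otimes>\<^sub>K U) \<Y> Y \<Z> Z"
  proof -
    obtain Q where Q: "markov_kernel \<Z> (\<X> \<Otimes>\<^sub>M \<U>) Q" and c: "\<And>t. t \<in> space T \<Longrightarrow>
        conditional_law (P t) (\<X> \<Otimes>\<^sub>M \<U>) (\<lambda>v. (x v, u v)) (\<Y> \<Otimes>\<^sub>M \<Z>) (\<lambda>v. (y v, z v)) (\<lambda>\<sigma>. Q (snd \<sigma>))"
      using h unfolding XU_Y_Z by blast
    have "markov_kernel \<Z> \<U> (\<lambda>c. distr (Q c) \<U> snd)"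
      by (rule measurable_compose[OF Q measurable_distr_prob_space]) simp
    then show ?thesis
      unfolding U_Y_Z using prob_space.conditional_law_map[OF P c measurable_snd]
      by (intro exI[of _ "\<lambda>c. distr (Q c) \<U> snd"]) simp
  qed
  \<comment> \<open>Conditioning on \<open>(y, (u, z))\<close> and on \<open>((y, u), z)\<close> is the same for a kernel in \<open>z\<close> alone.\<close>
  have regroup_condition: "conditional_law (P t) \<X> x (\<Y> \<Otimes>\<^sub>M \<U> \<Otimes>\<^sub>M \<Z>) (\<lambda>v. (y v, u v, z v)) (\<lambda>\<sigma>. Q (snd (snd \<sigma>)))
      \<longleftrightarrow> conditional_law (P t) \<X> x ((\<Y> \<Otimes>\<^sub>M \<U>) \<Otimes>\<^sub>M \<Z>) (\<lambda>v. ((y v, u v), z v)) (\<lambda>\<sigma>. Q (snd \<sigma>))"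
    if Q: "markov_kernel \<Z> \<X> Q" and t: "t \<in> space T" for Q t
  proof
    assume "conditional_law (P t) \<X> x (\<Y> \<Otimes>\<^sub>M \<U> \<Otimes>\<^sub>M \<Z>) (\<lambda>v. (y v, u v, z v)) (\<lambda>\<sigma>. Q (snd (snd \<sigma>)))"
    then show "conditional_law (P t) \<X> x ((\<Y> \<Otimes>\<^sub>M \<U>) \<Otimes>\<^sub>M \<Z>) (\<lambda>v. ((y v, u v), z v)) (\<lambda>\<sigma>. Q (snd \<sigma>))"
      by (rule prob_space.conditional_law_coarsen[OF P[OF t], where g = "\<lambda>(b, d, c). ((b, d), c)"])
         (use measurable_compose[OF measurable_snd Q] in \<open>simp_all add: case_prod_beta'\<close>)
  next
    assume "conditional_law (P t) \<X> x ((\<Y> \<Otimes>\<^sub>M \<U>) \<Otimes>\<^sub>M \<Z>) (\<lambda>v. ((y v, u v), z v)) (\<lambda>\<sigma>. Q (snd \<sigma>))"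
    then show "conditional_law (P t) \<X> x (\<Y> \<Otimes>\<^sub>M \<U> \<Otimes>\<^sub>M \<Z>) (\<lambda>v. (y v, u v, z v)) (\<lambda>\<sigma>. Q (snd (snd \<sigma>)))"
      by (rule prob_space.conditional_law_coarsen[OF P[OF t], where g = "\<lambda>((b, d), c). (b, d, c)"])
         (use measurable_compose[OF measurable_snd measurable_compose[OF measurable_snd Q]]
           in \<open>simp_all add: case_prod_beta'\<close>)
  qed
  have right_decomposition: "trans_ci T K \<X> X \<U> U \<Z> Z" if h: "trans_ci T K \<X> X (\<Y> \<Otimes>\<^sub>M \<U>) (Y \<Otimes>\<^sub>K U) \<Z> Z"
  proof -
    obtain Q where Q: "markov_kernel \<Z> \<X> Q" and c: "\<And>t. t \<in> space T \<Longrightarrow>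
        conditional_law (P t) \<X> x ((\<Y> \<Otimes>\<^sub>M \<U>) \<Otimes>\<^sub>M \<Z>) (\<lambda>v. ((y v, u v), z v)) (\<lambda>\<sigma>. Q (snd \<sigma>))"
      using h unfolding X_YU_Z by blast
    have "conditional_law (P t) \<X> x (\<U> \<Otimes>\<^sub>M \<Z>) (\<lambda>v. (u v, z v)) (\<lambda>\<sigma>. Q (snd \<sigma>))"
      if t: "t \<in> space T" for t
      by (rule prob_space.conditional_law_coarsen[OF P[OF t] c[OF t],
            where g = "\<lambda>p. (snd (fst p), snd p)"])
         (use measurable_compose[OF measurable_snd Q] in simp_all)
    with Q show ?thesis
      unfolding X_U_Z by blast
  qed
  have inverted_right_decomposition: "trans_ci T K \<X> X (T \<Otimes>\<^sub>M \<Y>) (input_var T \<Otimes>\<^sub>K Y) \<Z> Z" if h: "trans_ci T K \<X> X \<Y> Y \<Z> Z"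
  proof -
    obtain Q where Q: "markov_kernel \<Z> \<X> Q" and c: "\<And>t. t \<in> space T \<Longrightarrow>
        conditional_law (P t) \<X> x (\<Y> \<Otimes>\<^sub>M \<Z>) (\<lambda>v. (y v, z v)) (\<lambda>\<sigma>. Q (snd \<sigma>))"
      using h unfolding X_Y_Z by blast
    have "conditional_law (P t) \<X> x ((T \<Otimes>\<^sub>M \<Y>) \<Otimes>\<^sub>M \<Z>) (\<lambda>v. ((t, y v), z v)) (\<lambda>\<sigma>. Q (snd \<sigma>))"
      if t: "t \<in> space T" for t
      by (rule prob_space.conditional_law_coarsen[OF P[OF t] c[OF t],
            where g = "\<lambda>p. ((t, fst p), snd p)"])
         (use measurable_compose[OF measurable_snd Q] t in simp_all)
    with Q show ?thesis
      unfolding X_TY_Z by blast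
  qed
  have left_weak_union: "trans_ci T K \<X> X \<Y> Y (\<U> \<Otimes>\<^sub>M \<Z>) (U \<Otimes>\<^sub>K Z)"
    if dis: "disintegration_triple \<X> \<U> \<Z>" and h: "trans_ci T K (\<X> \<Otimes>\<^sub>M \<U>) (X \<Otimes>\<^sub>K U) \<Y> Y \<Z> Z"
  proof -
    obtain Q where Q: "markov_kernel \<Z> (\<X> \<Otimes>\<^sub>M \<U>) Q" and c: "\<And>t. t \<in> space T \<Longrightarrow>
        conditional_law (P t) (\<X> \<Otimes>\<^sub>M \<U>) (\<lambda>v. (x v, u v)) (\<Y> \<Otimes>\<^sub>M \<Z>) (\<lambda>v. (y v, z v)) (\<lambda>\<sigma>. Q (snd \<sigma>))"
      using h unfolding XU_Y_Z by blast
    obtain L where L: "markov_kernel (\<U> \<Otimes>\<^sub>M \<Z>) \<X> L" and cL: "\<And>c. c \<in> space \<Z> \<Longrightarrow>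
        conditional_law (Q c) \<X> fst \<U> snd (\<lambda>b. L (b, c))"
      using disintegration_tripleD[OF dis Q] by blast
    \<comment> \<open>Splitting \<open>u\<close> off from \<open>(x, u)\<close> given \<open>(y, z)\<close> yields a law given \<open>(u, (y, z))\<close>; the first two
      entries are exchanged afterwards.\<close>
    have LY: "markov_kernel (\<U> \<Otimes>\<^sub>M \<Y> \<Otimes>\<^sub>M \<Z>) \<X> (\<lambda>(d, b, c). L (d, c))"
      using measurable_compose[OF _ L, of "\<lambda>(d, b, c). (d, c)" "\<U> \<Otimes>\<^sub>M \<Y> \<Otimes>\<^sub>M \<Z>"]
      by (simp add: case_prod_beta')
    have "conditional_law (P t) \<X> x (\<Y> \<Otimes>\<^sub>M \<U> \<Otimes>\<^sub>M \<Z>) (\<lambda>v. (y v, u v, z v)) (\<lambda>\<sigma>. L (snd \<sigma>))"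
      if t: "t \<in> space T" for t
    proof (rule prob_space.conditional_law_coarsen[OF P[OF t], where g = "\<lambda>(d, b, c). (b, d, c)"])
      show "conditional_law (P t) \<X> x (\<U> \<Otimes>\<^sub>M \<Y> \<Otimes>\<^sub>M \<Z>) (\<lambda>v. (u v, y v, z v)) (\<lambda>(d, b, c). L (d, c))"
        by (rule prob_space.conditional_law_disintegrate[OF P[OF t] c[OF t] LY])
           (auto simp: space_pair_measure cL)
      show "markov_kernel (\<Y> \<Otimes>\<^sub>M \<U> \<Otimes>\<^sub>M \<Z>) \<X> (\<lambda>\<sigma>. L (snd \<sigma>))"
        by (rule measurable_compose[OF measurable_snd L])
    qed (auto simp: case_prod_beta')
    with L show ?thesis
      unfolding X_Y_UZ by blast
  qed
  have right_weak_union: "trans_ci T K \<X> X \<Y> Y (\<U> \<Otimes>\<^sub>M \<Z>) (U \<Otimes>\<^sub>K Z)"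
    if h: "trans_ci T K \<X> X (\<Y> \<Otimes>\<^sub>M \<U>) (Y \<Otimes>\<^sub>K U) \<Z> Z"
  proof -
    obtain Q where Q: "markov_kernel \<Z> \<X> Q" and c: "\<And>t. t \<in> space T \<Longrightarrow>
        conditional_law (P t) \<X> x ((\<Y> \<Otimes>\<^sub>M \<U>) \<Otimes>\<^sub>M \<Z>) (\<lambda>v. ((y v, u v), z v)) (\<lambda>\<sigma>. Q (snd \<sigma>))"
      using h unfolding X_YU_Z by blast
    show ?thesis
      unfolding X_Y_UZ
      using c regroup_condition[OF Q] measurable_compose[OF measurable_snd Q]
      by (intro exI[of _ "\<lambda>p. Q (snd p)"]) simp
  qed
  have left_contraction: "trans_ci T K (\<X> \<Otimes>\<^sub>M \<U>) (X \<Otimes>\<^sub>K U) \<Y> Y \<Z> Z"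
    if h1: "trans_ci T K \<X> X \<Y> Y (\<U> \<Otimes>\<^sub>M \<Z>) (U \<Otimes>\<^sub>K Z)" and h2: "trans_ci T K \<U> U \<Y> Y \<Z> Z"
  proof -
    obtain Q where Q: "markov_kernel (\<U> \<Otimes>\<^sub>M \<Z>) \<X> Q" and c: "\<And>t. t \<in> space T \<Longrightarrow>
        conditional_law (P t) \<X> x (\<Y> \<Otimes>\<^sub>M \<U> \<Otimes>\<^sub>M \<Z>) (\<lambda>v. (y v, u v, z v)) (\<lambda>\<sigma>. Q (snd \<sigma>))"
      using h1 unfolding X_Y_UZ by blast
    obtain N where N: "markov_kernel \<Z> \<U> N" and cN: "\<And>t. t \<in> space T \<Longrightarrow>
        conditional_law (P t) \<U> u (\<Y> \<Otimes>\<^sub>M \<Z>) (\<lambda>v. (y v, z v)) (\<lambda>\<sigma>. N (snd \<sigma>))"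
      using h2 unfolding U_Y_Z by blast
    have QY: "markov_kernel (\<U> \<Otimes>\<^sub>M \<Y> \<Otimes>\<^sub>M \<Z>) \<X> (\<lambda>(d, b, c). Q (d, c))"
      using measurable_compose[OF _ Q, of "\<lambda>(d, b, c). (d, c)" "\<U> \<Otimes>\<^sub>M \<Y> \<Otimes>\<^sub>M \<Z>"]
      by (simp add: case_prod_beta')
    have "conditional_law (P t) \<X> x (\<U> \<Otimes>\<^sub>M \<Y> \<Otimes>\<^sub>M \<Z>) (\<lambda>v. (u v, y v, z v)) (\<lambda>(d, b, c). Q (d, c))"
      if t: "t \<in> space T" for t
      by (rule prob_space.conditional_law_coarsen[OF P[OF t] c[OF t],
            where g = "\<lambda>(b, d, c). (d, b, c)", OF _ QY])
         (auto simp: case_prod_beta')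
    from prob_space.conditional_law_chain[OF P this cN]
    show ?thesis
      unfolding XU_Y_Z using measurable_chain_kernel[OF Q N]
      by (intro exI[of _ "\<lambda>c. N c \<bind> (\<lambda>b. Q (b, c) \<Otimes>\<^sub>M return \<U> b)"]) (simp add: case_prod_beta')
  qed
  have right_contraction: "trans_ci T K \<X> X (\<Y> \<Otimes>\<^sub>M \<U>) (Y \<Otimes>\<^sub>K U) \<Z> Z"
    if h1: "trans_ci T K \<X> X \<Y> Y (\<U> \<Otimes>\<^sub>M \<Z>) (U \<Otimes>\<^sub>K Z)" and h2: "trans_ci T K \<X> X \<U> U \<Z> Z"
  proof -
    obtain Q where Q: "markov_kernel (\<U> \<Otimes>\<^sub>M \<Z>) \<X> Q" and c: "\<And>t. t \<in> space T \<Longrightarrow>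
        conditional_law (P t) \<X> x (\<Y> \<Otimes>\<^sub>M \<U> \<Otimes>\<^sub>M \<Z>) (\<lambda>v. (y v, u v, z v)) (\<lambda>\<sigma>. Q (snd \<sigma>))"
      using h1 unfolding X_Y_UZ by blast
    obtain R where R: "markov_kernel \<Z> \<X> R" and cR: "\<And>t. t \<in> space T \<Longrightarrow>
        conditional_law (P t) \<X> x (\<U> \<Otimes>\<^sub>M \<Z>) (\<lambda>v. (u v, z v)) (\<lambda>\<sigma>. R (snd \<sigma>))"
      using h2 unfolding X_U_Z by blast
    have "conditional_law (P t) \<X> x (\<Y> \<Otimes>\<^sub>M \<U> \<Otimes>\<^sub>M \<Z>) (\<lambda>v. (y v, u v, z v)) (\<lambda>\<sigma>. R (snd (snd \<sigma>)))"
      if t: "t \<in> space T" for t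
      by (rule prob_space.conditional_law_contract[OF P[OF t] c[OF t] measurable_snd Q _ _ cR[OF t]]) simp_all
    with R show ?thesis
      unfolding X_YU_Z using regroup_condition[OF R] by blast
  qed
  have right_cross_contraction: "trans_ci T K \<X> X (\<Y> \<Otimes>\<^sub>M \<U>) (Y \<Otimes>\<^sub>K U) \<Z> Z"
    if h1: "trans_ci T K \<X> X \<Y> Y (\<U> \<Otimes>\<^sub>M \<Z>) (U \<Otimes>\<^sub>K Z)" and h2: "trans_ci T K \<U> U \<X> X \<Z> Z"
  proof (rule right_contraction[OF h1])
    obtain Q where Q: "markov_kernel (\<U> \<Otimes>\<^sub>M \<Z>) \<X> Q" and c: "\<And>t. t \<in> space T \<Longrightarrow>
        conditional_law (P t) \<X> x (\<Y> \<Otimes>\<^sub>M \<U> \<Otimes>\<^sub>M \<Z>) (\<lambda>v. (y v, u v, z v)) (\<lambda>\<sigma>. Q (snd \<sigma>))"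
      using h1 unfolding X_Y_UZ by blast
    obtain N where N: "markov_kernel \<Z> \<U> N" and cN: "\<And>t. t \<in> space T \<Longrightarrow>
        conditional_law (P t) \<U> u (\<X> \<Otimes>\<^sub>M \<Z>) (\<lambda>v. (x v, z v)) (\<lambda>\<sigma>. N (snd \<sigma>))"
      using h2 unfolding U_X_Z by blast
    \<comment> \<open>The law of \<open>x\<close> given \<open>z\<close>: average the law given \<open>(u, z)\<close> over \<open>u\<close> given \<open>z\<close>.\<close>
    let ?R = "\<lambda>c. distr (N c \<bind> (\<lambda>b. Q (b, c) \<Otimes>\<^sub>M return \<U> b)) \<X> fst"
    have R: "markov_kernel \<Z> \<X> ?R"
      by (rule measurable_compose[OF measurable_chain_kernel[OF Q N] measurable_distr_prob_space]) simp
    have "conditional_law (P t) \<X> x (\<U> \<Otimes>\<^sub>M \<Z>) (\<lambda>v. (u v, z v)) (\<lambda>\<sigma>. ?R (snd \<sigma>))"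
      if t: "t \<in> space T" for t
    proof (rule prob_space.conditional_law_symmetric[OF P[OF t] _ cN[OF t] N])
      have cQ: "conditional_law (P t) \<X> x (\<U> \<Otimes>\<^sub>M \<Z>) (\<lambda>v. (u v, z v)) Q"
        by (rule prob_space.conditional_law_coarsen[OF P[OF t] c[OF t] measurable_snd Q]) simp_all
      have cN': "conditional_law (P t) \<U> u \<Z> z N"
        by (rule prob_space.conditional_law_coarsen[OF P[OF t] cN[OF t] measurable_snd N]) simp_all
      show "conditional_law (P t) \<X> x \<Z> z ?R"
        using prob_space.conditional_law_map[OF P[OF t]
            prob_space.conditional_law_chain[OF P[OF t] cQ cN'] measurable_fst]
        by simp
    qed
    with R show "trans_ci T K \<X> X \<U> U \<Z> Z"
      unfolding X_U_Z by (intro exI[of _ ?R]) simp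
  qed
  have flipped_left_cross_contraction: "trans_ci T K \<Y> Y (\<X> \<Otimes>\<^sub>M \<U>) (X \<Otimes>\<^sub>K U) \<Z> Z"
    if h1: "trans_ci T K \<X> X \<Y> Y (\<U> \<Otimes>\<^sub>M \<Z>) (U \<Otimes>\<^sub>K Z)" and h2: "trans_ci T K \<Y> Y \<U> U \<Z> Z"
  proof -
    obtain Q where Q: "markov_kernel (\<U> \<Otimes>\<^sub>M \<Z>) \<X> Q" and c: "\<And>t. t \<in> space T \<Longrightarrow>
        conditional_law (P t) \<X> x (\<Y> \<Otimes>\<^sub>M \<U> \<Otimes>\<^sub>M \<Z>) (\<lambda>v. (y v, u v, z v)) (\<lambda>\<sigma>. Q (snd \<sigma>))"
      using h1 unfolding X_Y_UZ by blast
    obtain N where N: "markov_kernel \<Z> \<Y> N" and cN: "\<And>t. t \<in> space T \<Longrightarrow>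
        conditional_law (P t) \<Y> y (\<U> \<Otimes>\<^sub>M \<Z>) (\<lambda>v. (u v, z v)) (\<lambda>\<sigma>. N (snd \<sigma>))"
      using h2 unfolding Y_U_Z by blast
    \<comment> \<open>Symmetry is applied with \<open>(u, z)\<close> as the conditioning variable and the kernel of \<open>y\<close> given
      \<open>(u, z)\<close> that reads only \<open>z\<close>.\<close>
    have "conditional_law (P t) \<Y> y ((\<X> \<Otimes>\<^sub>M \<U>) \<Otimes>\<^sub>M \<Z>) (\<lambda>v. ((x v, u v), z v)) (\<lambda>\<sigma>. N (snd \<sigma>))"
      if t: "t \<in> space T" for t
      by (rule prob_space.conditional_law_coarsen[OF P[OF t]
            prob_space.conditional_law_symmetric[OF P[OF t] cN[OF t] c[OF t] Q],
            where g = "\<lambda>(a, d, c). ((a, d), c)"])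
         (use measurable_compose[OF measurable_snd N] in \<open>simp_all add: case_prod_beta'\<close>)
    with N show ?thesis
      unfolding Y_XU_Z by blast
  qed
  show ?thesis
    using left_redundancy right_redundancy left_decomposition right_decomposition
      inverted_right_decomposition left_weak_union right_weak_union left_contraction
      right_contraction right_cross_contraction flipped_left_cross_contraction by blast
qed

end
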